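(* Let $\overline{p}$ be a finite set of propositional variables. For every consistent $\mathrm{CTL}^f$-formula $\phi_0(\overline{p})$, there exists a $\overline{p}$-coloured tree with root $s_0$ such that $s_0 \Vdash \phi_0$.
   Context: **Formulas.** $\mathrm{CTL}^f$-formulas with variables in $\overline p$ are the terms built from variables $p\in\overline p$ using the nullary symbol $\bot$, unary symbols $\neg,\Diamond$, and binary symbols $\vee,\mathrm{EU},\mathrm{EG}$. As usual $\top:=\neg\bot$ and $a\wedge b:=\neg(\neg a\vee\neg b)$. **Algebras.** A $\mathrm{CTL}^f$-algebra is a tuple $(A,\bot,\vee,\neg,\Diamond,\mathrm{EU},\mathrm{EG})$ such that $(A,\bot,\vee,\neg)$ is a Boolean algebra ($a\le b$ means $a\vee b=b$); $\Diamond:A\to A$ preserves finite joins including the empty join $\bot$; $\Diamond\top=\top$; and for all $a,b\in A$, $\mathrm{EU}(a,b)$ is the least pre-fixpoint of $x\mapsto a\vee(b\wedge\Diamond x)$ (the least $x$ with $a\vee(b\wedge\Diamond x)\le x$) and $\mathrm{EG}(a,b)$ is the greatest post-fixpoint of $y\mapsto a\wedge\Diamond\mathrm{EU}(b\wedge y,a)$ (the greatest $y$ with $y\le a\wedge\Diamond\mathrm{EU}(b\wedge y,a)$). A formula $\phi(\overline p)$ is *consistent* if there are a $\mathrm{CTL}^f$-algebra $\mathbb A$ and a valuation $V:\overline p\to A$ such that the interpretation of $\phi$ in $\mathbb A$ under $V$ is not $\bot$. **Transition systems and trees.** A transition system is a set $S$ with a binary relation $R$; all transition systems are assumed serial: every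 $s\in S$ has some $s'$ with $sRs'$. An $R$-path is a finite or infinite sequence of nodes with $s_iRs_{i+1}$ for all $i$. A *root* is a node $s_0$ such that every node is reachable by a path from $s_0$, and the only path ending in $s_0$ is the trivial one. A *tree* is a transition system with a root such that for every node $s$ there is a unique path from the root to $s$. A $\overline p$-colouring is a function $\sigma:S\to\mathcal P(\overline p)$; a $\overline p$-coloured tree is a tree with a $\overline p$-colouring. **Forcing.** For a coloured transition system $(S,R,\sigma)$: $s\not\Vdash\bot$; $s\Vdash p$ iff $p\in\sigma(s)$; $s\Vdash\neg\psi$ iff $s\not\Vdash\psi$; $s\Vdash\psi_1\vee\psi_2$ iff $s\Vdash\psi_1$ or $s\Vdash\psi_2$; $s\Vdash\Diamond\psi$ iff some $s'$ with $sRs'$ has $s'\Vdash\psi$; $s\Vdash\mathrm{EU}(\psi_1,\psi_2)$ iff there are $n\ge0$ and an $R$-path $s=s_0,\dots,s_n$ with $s_t\Vdash\psi_2$ for all $t<n$ and $s_n\Vdash\psi_1$; $s\Vdash\mathrm{EG}(\psi_1,\psi_2)$ iff there is an infinite $R$-path $s=s_0,s_1,\dots$ with $s_t\Vdash\psi_1$ for all $t$ and $s_t\Vdash\psi_2$ for infinitely many $t$. *)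

theory Defs
  imports Main
begin

datatype (vars: 'p) ctlf =
    Var 'p
  | Bot
  | Neg "'p ctlf"
  | Dia "'p ctlf"
  | Or "'p ctlf" "'p ctlf"
  | EU "'p ctlf" "'p ctlf"
  | EG "'p ctlf" "'p ctlf"

text \<open>The Boolean reduct of an algebra is the structure of the type class
  \<^class>\<open>boolean_algebra\<close> on the type \<^typ>\<open>'a\<close>, whose order satisfies
  \<open>a \<le> b \<longleftrightarrow> sup a b = b\<close>.\<close>

locale ctlf_algebra =
  fixes dia :: "'a::boolean_algebra \<Rightarrow> 'a"
    and eu :: "'a \<Rightarrow> 'a \<Rightarrow> 'a"
    and eg :: "'a \<Rightarrow> 'a \<Rightarrow> 'a"
  assumes dia_bot: "dia bot = bot"
    and dia_sup: "dia (sup a b) = sup (dia a) (dia b)"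
    and dia_top: "dia top = top"
    and eu_prefix: "sup a (inf b (dia (eu a b))) \<le> eu a b"
    and eu_least: "sup a (inf b (dia x)) \<le> x \<Longrightarrow> eu a b \<le> x"
    and eg_postfix: "eg a b \<le> inf a (dia (eu (inf b (eg a b)) a))"
    and eg_greatest: "y \<le> inf a (dia (eu (inf b y) a)) \<Longrightarrow> y \<le> eg a b"

primrec interp ::
  "('a::boolean_algebra \<Rightarrow> 'a) \<Rightarrow> ('a \<Rightarrow> 'a \<Rightarrow> 'a) \<Rightarrow> ('a \<Rightarrow> 'a \<Rightarrow> 'a) \<Rightarrow> ('p \<Rightarrow> 'a) \<Rightarrow> 'p ctlf \<Rightarrow> 'a"
where
  "interp dia eu eg V (Var p) = V p"
| "interp dia eu eg V Bot = bot"
| "interp dia eu eg V (Neg \<phi>) = - interp dia eu eg V \<phi>"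
| "interp dia eu eg V (Dia \<phi>) = dia (interp dia eu eg V \<phi>)"
| "interp dia eu eg V (Or \<phi> \<psi>) = sup (interp dia eu eg V \<phi>) (interp dia eu eg V \<psi>)"
| "interp dia eu eg V (EU \<phi> \<psi>) = eu (interp dia eu eg V \<phi>) (interp dia eu eg V \<psi>)"
| "interp dia eu eg V (EG \<phi> \<psi>) = eg (interp dia eu eg V \<phi>) (interp dia eu eg V \<psi>)"

text \<open>HOL cannot quantify existentially over types, so consistency is relative to the type
  carrying the algebra. As a hypothesis of a theorem that is polymorphic in \<^typ>\<open>'a\<close> and does
  not mention \<^typ>\<open>'a\<close> elsewhere, it amounts to the existence of an arbitrary such algebra.
  The values of \<open>V\<close> on variables not occurring in \<open>\<phi>\<close> are irrelevant.\<close>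

definition consistent :: "'a::boolean_algebra itself \<Rightarrow> 'p ctlf \<Rightarrow> bool" where
  "consistent (_ :: 'a itself) \<phi> \<longleftrightarrow>
     (\<exists>(dia :: 'a \<Rightarrow> 'a) eu eg (V :: 'p \<Rightarrow> 'a).
        ctlf_algebra dia eu eg \<and> interp dia eu eg V \<phi> \<noteq> bot)"

locale transition_system =
  fixes S :: "'s set" and R :: "'s rel"
  assumes R_subset: "R \<subseteq> S \<times> S"
    and serial: "s \<in> S \<Longrightarrow> \<exists>s'. (s, s') \<in> R"

text \<open>A finite path \<open>s\<^sub>0, \<dots>, s\<^sub>n\<close> is the list of its \<open>n + 1\<close> nodes;
  the trivial path at \<open>s\<close> is \<open>[s]\<close>.\<close>

definition fin_path :: "'s set \<Rightarrow> 's rel \<Rightarrow> 's list \<Rightarrow> bool" where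
  "fin_path S R xs \<longleftrightarrow>
     xs \<noteq> [] \<and> set xs \<subseteq> S \<and> (\<forall>i. Suc i < length xs \<longrightarrow> (xs ! i, xs ! Suc i) \<in> R)"

definition inf_path :: "'s set \<Rightarrow> 's rel \<Rightarrow> (nat \<Rightarrow> 's) \<Rightarrow> bool" where
  "inf_path S R \<pi> \<longleftrightarrow> (\<forall>i. \<pi> i \<in> S \<and> (\<pi> i, \<pi> (Suc i)) \<in> R)"

definition is_root :: "'s set \<Rightarrow> 's rel \<Rightarrow> 's \<Rightarrow> bool" where
  "is_root S R r \<longleftrightarrow>
     r \<in> S \<and>
     (\<forall>s\<in>S. \<exists>xs. fin_path S R xs \<and> hd xs = r \<and> last xs = s) \<and>
     (\<forall>xs. fin_path S R xs \<and> last xs = r \<longrightarrow> xs = [r])"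

locale rooted_tree = transition_system S R
  for S :: "'s set" and R :: "'s rel" +
  fixes r :: 's
  assumes root: "is_root S R r"
    and unique_path: "s \<in> S \<Longrightarrow> \<exists>!xs. fin_path S R xs \<and> hd xs = r \<and> last xs = s"

definition colouring :: "'p set \<Rightarrow> 's set \<Rightarrow> ('s \<Rightarrow> 'p set) \<Rightarrow> bool" where
  "colouring P S \<sigma> \<longleftrightarrow> (\<forall>s\<in>S. \<sigma> s \<subseteq> P)"

primrec forces :: "'s set \<Rightarrow> 's rel \<Rightarrow> ('s \<Rightarrow> 'p set) \<Rightarrow> 's \<Rightarrow> 'p ctlf \<Rightarrow> bool" where
  "forces S R \<sigma> s (Var p) \<longleftrightarrow> p \<in> \<sigma> s"
| "forces S R \<sigma> s Bot \<longleftrightarrow> False"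
| "forces S R \<sigma> s (Neg \<psi>) \<longleftrightarrow> \<not> forces S R \<sigma> s \<psi>"
| "forces S R \<sigma> s (Dia \<psi>) \<longleftrightarrow> (\<exists>s'. (s, s') \<in> R \<and> forces S R \<sigma> s' \<psi>)"
| "forces S R \<sigma> s (Or \<psi>1 \<psi>2) \<longleftrightarrow> forces S R \<sigma> s \<psi>1 \<or> forces S R \<sigma> s \<psi>2"
| "forces S R \<sigma> s (EU \<psi>1 \<psi>2) \<longleftrightarrow>
     (\<exists>n xs. fin_path S R xs \<and> length xs = Suc n \<and> xs ! 0 = s \<and>
        (\<forall>t<n. forces S R \<sigma> (xs ! t) \<psi>2) \<and> forces S R \<sigma> (xs ! n) \<psi>1)"
| "forces S R \<sigma> s (EG \<psi>1 \<psi>2) \<longleftrightarrow>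
     (\<exists>\<pi>. inf_path S R \<pi> \<and> \<pi> 0 = s \<and>
        (\<forall>t. forces S R \<sigma> (\<pi> t) \<psi>1) \<and> infinite {t. forces S R \<sigma> (\<pi> t) \<psi>2})"

end

theory Submission
  imports Defs "HOL-Library.Nat_Bijection"
begin

text \<open>The model is the unravelling of a strategy on the ultrafilters of the given algebra. Let
  \<open>u\<close> see \<open>v\<close> when \<open>dia c \<in> u\<close> for all \<open>c \<in> v\<close>. In this
  canonical frame \<open>dia\<close> is interpreted correctly, but not \<open>eu\<close> and \<open>eg\<close>: the
  algebra says nothing about paths between ultrafilters beyond finitely many steps. So the tree
  uses only some of the successors, chosen such that three kinds of tasks are carried out:
  \<open>Next c\<close> asks for a child containing \<open>c\<close> if \<open>dia c\<close> holds;
  \<open>Reach a b\<close> asks for a branch witnessing \<open>eu a b\<close> where \<open>eu a b\<close> holds; and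
  \<open>Avoid a b\<close> asks, where \<open>eg a b\<close> fails, that every branch along which \<open>a\<close>
  always holds meets \<open>b\<close> only finitely often. A branch witnessing \<open>eg a b\<close> where it
  holds is put together from witnesses of \<open>eu (inf b (eg a b)) a\<close>.

  Each \<open>Reach\<close> and \<open>Avoid\<close> task comes with a rank, which a strategy can decrease.
  Let \<open>F\<close> be a finite set of elements, and call the trace of an ultrafilter on \<open>F\<close> its
  type. To the task belongs a monotone map \<open>advance\<close> on the algebra whose only pre-fixpoint
  is \<open>top\<close>; this is where the extremality of \<open>eu\<close> and \<open>eg\<close> enters. Iterating
  it from \<open>bot\<close>, and closing the result under equality of types after each round, exhausts
  the algebra after finitely many rounds, since there are finitely many types. The rank of an
  ultrafilter is the number of the round in which it is covered. An ultrafilter in which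
  \<open>eu a b\<close> holds and \<open>a\<close> fails has a successor whose type admits a smaller rank
  (lemma \<open>Reach_rank\<close>). If \<open>eg a b\<close> fails and \<open>a\<close> holds in \<open>u\<close>, then
  every successor of \<open>u\<close> either has a type admitting a smaller rank, or does not contain
  \<open>b\<close> and has itself no larger rank (lemma \<open>Avoid_rank\<close>). If each
  chosen successor is replaced by an ultrafilter of the same type and of minimal rank, then the rank
  for a single task does not increase before the task is discharged. It decreases in every step
  towards the goal of a \<open>Reach\<close> task, and whenever \<open>b\<close> is met in the case of
  \<open>Avoid a b\<close>.

  Such replacements change the ranks for the other tasks. Therefore the tasks are kept in a
  priority list, and the types for position \<open>j\<close> of the list are traces on a set
  \<open>level j\<close>, where \<open>level (j + 1)\<close> contains the elements that determine the ranks over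
  \<open>level j\<close>. A replacement for the sake of position \<open>j\<close> keeps the
  trace on \<open>level j\<close>, hence the ranks at all positions before \<open>j\<close>. After each step
  the first discharged task of the list is moved to its end. If some task is from some time on
  never discharged along a branch, then the part of the list up to that task eventually does not
  change, and the ranks at these positions become constant one after the other. For a
  \<open>Reach\<close> task this is impossible, and for an \<open>Avoid\<close> task it means that \<open>b\<close>
  is met finitely often (lemma \<open>run_undischarged\<close>).\<close>

section \<open>Ultrafilters of a Boolean algebra\<close>

text \<open>An ultrafilter is given by its behaviour as a homomorphism onto the two-element Boolean
  algebra; \<open>proper_filter\<close> below is the usual notion, of which the ultrafilters are the maximal
  instances.\<close>

definition ultrafilter :: "'a::boolean_algebra set \<Rightarrow> bool" where
  "ultrafilter u \<longleftrightarrow>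
     bot \<notin> u \<and> (\<forall>a b. inf a b \<in> u \<longleftrightarrow> a \<in> u \<and> b \<in> u) \<and> (\<forall>a. - a \<in> u \<longleftrightarrow> a \<notin> u)"

lemma ultrafilter_bot: "ultrafilter u \<Longrightarrow> bot \<notin> u"
  and ultrafilter_inf: "ultrafilter u \<Longrightarrow> inf a b \<in> u \<longleftrightarrow> a \<in> u \<and> b \<in> u"
  and ultrafilter_compl: "ultrafilter u \<Longrightarrow> - a \<in> u \<longleftrightarrow> a \<notin> u"
  by (auto simp: ultrafilter_def)

lemma ultrafilter_sup: "ultrafilter u \<Longrightarrow> sup a b \<in> u \<longleftrightarrow> a \<in> u \<or> b \<in> u"
  using ultrafilter_inf[of u "- a" "- b"] ultrafilter_compl[of u "sup a b"]
    ultrafilter_compl[of u a] ultrafilter_compl[of u b] by (simp add: compl_sup) metis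

lemma ultrafilter_top: "ultrafilter u \<Longrightarrow> top \<in> u"
  using ultrafilter_compl[of u bot] ultrafilter_bot[of u] by simp

lemmas ultrafilter_simps = ultrafilter_bot ultrafilter_top ultrafilter_inf ultrafilter_sup
  ultrafilter_compl

lemma ultrafilter_mono: "ultrafilter u \<Longrightarrow> a \<le> b \<Longrightarrow> a \<in> u \<Longrightarrow> b \<in> u"
  by (metis inf.absorb1 ultrafilter_inf)

definition proper_filter :: "'a::boolean_algebra set \<Rightarrow> bool" where
  "proper_filter u \<longleftrightarrow> u \<noteq> {} \<and> bot \<notin> u \<and> (\<forall>a\<in>u. \<forall>b\<in>u. inf a b \<in> u) \<and>
     (\<forall>a\<in>u. \<forall>b. a \<le> b \<longrightarrow> b \<in> u)"

lemma maximal_proper_filter_ultrafilter: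
  assumes M: "proper_filter M" and max: "\<And>N. proper_filter N \<Longrightarrow> M \<subseteq> N \<Longrightarrow> N = M"
  shows "ultrafilter M"
proof -
  have inf: "inf a b \<in> M \<longleftrightarrow> a \<in> M \<and> b \<in> M" for a b
    using M unfolding proper_filter_def by (meson inf_le1 inf_le2)
  have compl: "- a \<in> M" if "a \<notin> M" for a
  proof (rule ccontr)
    assume na: "- a \<notin> M"
    define N where "N = {c. \<exists>m\<in>M. inf m a \<le> c}"
    obtain m0 where m0: "m0 \<in> M" using M by (auto simp: proper_filter_def)
    have "proper_filter N"
      unfolding proper_filter_def
    proof (intro conjI ballI allI impI)
      show "N \<noteq> {}" using m0 by (auto simp: N_def)
      show "bot \<notin> N"
      proof
        assume "bot \<in> N"
        then obtain m where m: "m \<in> M" "inf m a \<le> bot" by (auto simp: N_def)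
        then have "m \<le> - a" by (metis bot_unique inf_shunt)
        then show False using na m M by (auto simp: proper_filter_def)
      qed
    next
      fix c d assume "c \<in> N" "d \<in> N"
      then obtain m n where "m \<in> M" "n \<in> M" "inf m a \<le> c" "inf n a \<le> d"
        by (auto simp: N_def)
      moreover from this have "inf (inf m n) a \<le> inf c d"
        by (meson inf_le1 inf_le2 inf_mono le_infI order_refl order_trans)
      ultimately show "inf c d \<in> N" using inf by (auto simp: N_def)
    next
      fix c d assume "c \<in> N" "c \<le> d"
      then show "d \<in> N" by (auto simp: N_def intro: order_trans)
    qed
    moreover have "M \<subseteq> N" unfolding N_def using inf_le1 by blast
    moreover have "a \<in> N" using m0 by (auto simp: N_def)
    ultimately show False using max that by auto
  qed
  have bot: "bot \<notin> M" using M by (simp add: proper_filter_def)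
  then have "\<not> (a \<in> M \<and> - a \<in> M)" for a
    using inf[of a "- a"] by simp
  then have "- a \<in> M \<longleftrightarrow> a \<notin> M" for a using compl by metis
  then show ?thesis using inf bot by (simp add: ultrafilter_def)
qed

text \<open>The ultrafilter theorem, for a set \<open>G\<close> closed under binary meets; the filter to extend is its
  upward closure.\<close>

lemma ultrafilter_extension:
  assumes "G \<noteq> {}" "bot \<notin> G" "\<And>a b. a \<in> G \<Longrightarrow> b \<in> G \<Longrightarrow> inf a b \<in> G"
  obtains u where "ultrafilter u" "G \<subseteq> u"
proof -
  define G' where "G' = {c. \<exists>g\<in>G. g \<le> c}"
  have G': "proper_filter G'"
    unfolding proper_filter_def
  proof (intro conjI ballI allI impI)
    show "G' \<noteq> {}" using assms(1) by (auto simp: G'_def)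
    show "bot \<notin> G'" using assms(2) by (auto simp: G'_def bot_unique)
  next
    fix c d assume "c \<in> G'" "d \<in> G'"
    then obtain g g' where "g \<in> G" "g \<le> c" "g' \<in> G" "g' \<le> d" by (auto simp: G'_def)
    then have "inf g g' \<in> G" "inf g g' \<le> inf c d" using assms(3) inf_mono[of g c g' d] by simp_all
    then show "inf c d \<in> G'" unfolding G'_def by blast
  next
    fix c d assume "c \<in> G'" "c \<le> d"
    then show "d \<in> G'" by (auto simp: G'_def intro: order_trans)
  qed
  have "\<exists>M\<in>{N. proper_filter N \<and> G' \<subseteq> N}. \<forall>X\<in>{N. proper_filter N \<and> G' \<subseteq> N}. M \<subseteq> X \<longrightarrow> X = M"
  proof (rule subset_Zorn_nonempty)
    show "{N. proper_filter N \<and> G' \<subseteq> N} \<noteq> {}" using G' by auto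
  next
    fix \<C> assume ne: "\<C> \<noteq> {}" and ch: "subset.chain {N. proper_filter N \<and> G' \<subseteq> N} \<C>"
    have pf: "proper_filter N" "G' \<subseteq> N" if "N \<in> \<C>" for N
      using ch that by (auto simp: subset_chain_def)
    have dir: "N \<subseteq> N' \<or> N' \<subseteq> N" if "N \<in> \<C>" "N' \<in> \<C>" for N N'
      using ch that by (simp add: subset_chain_def)
    have "proper_filter (\<Union>\<C>)"
      unfolding proper_filter_def
    proof (intro conjI ballI allI impI)
      show "\<Union>\<C> \<noteq> {}" using ne pf(1) by (fastforce simp: proper_filter_def)
      show "bot \<notin> \<Union>\<C>" using pf(1) by (auto simp: proper_filter_def)
    next
      fix c d assume "c \<in> \<Union>\<C>" "d \<in> \<Union>\<C>"
      then obtain N where "N \<in> \<C>" "c \<in> N" "d \<in> N" using dir by blast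
      then show "inf c d \<in> \<Union>\<C>" using pf(1) by (auto simp: proper_filter_def)
    next
      fix c d assume "c \<in> \<Union>\<C>" "c \<le> d"
      then show "d \<in> \<Union>\<C>" using pf(1) by (fastforce simp: proper_filter_def)
    qed
    then show "\<Union>\<C> \<in> {N. proper_filter N \<and> G' \<subseteq> N}" using ne pf(2) by blast
  qed
  then obtain M where "proper_filter M" "G' \<subseteq> M"
    and "\<And>X. proper_filter X \<Longrightarrow> G' \<subseteq> X \<Longrightarrow> M \<subseteq> X \<Longrightarrow> X = M" by auto
  moreover from this have "ultrafilter M"
    by (intro maximal_proper_filter_ultrafilter) auto
  moreover have "G \<subseteq> G'" by (auto simp: G'_def)
  ultimately show thesis using that by blast
qed

lemma ultrafilter_exists:
  assumes "x \<noteq> bot" obtains u where "ultrafilter u" "x \<in> u"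
  using ultrafilter_extension[of "{x}"] assms by auto

lemma le_by_ultrafilters:
  assumes "\<And>u. ultrafilter u \<Longrightarrow> a \<in> u \<Longrightarrow> b \<in> u"
  shows "a \<le> b"
proof (rule ccontr)
  assume "\<not> a \<le> b"
  then have "inf a (- b) \<noteq> bot" by (simp add: inf_shunt)
  then show False
    using assms ultrafilter_exists[of "inf a (- b)"] by (metis ultrafilter_compl ultrafilter_inf)
qed

section \<open>Ranks over finitely many types\<close>

text \<open>The type of an ultrafilter \<open>u\<close> over a finite set \<open>F\<close> is the set \<open>u \<inter> F\<close>. Every
  set of types over \<open>F\<close> is defined by an element of the algebra.\<close>

lemma type_element_single:
  assumes "finite (F :: 'a::boolean_algebra set)"
  shows "\<exists>z. \<forall>u. ultrafilter u \<longrightarrow> (z \<in> u \<longleftrightarrow> u \<inter> F = T \<inter> F)"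
  using assms
proof (induction F rule: finite_induct)
  case empty
  show ?case by (rule exI[of _ top]) (auto simp: ultrafilter_simps)
next
  case (insert x F)
  then obtain z where z: "\<And>u. ultrafilter u \<Longrightarrow> z \<in> u \<longleftrightarrow> u \<inter> F = T \<inter> F" by auto
  have "u \<inter> insert x F = T \<inter> insert x F \<longleftrightarrow> u \<inter> F = T \<inter> F \<and> (x \<in> u \<longleftrightarrow> x \<in> T)" for u
    using insert.hyps by blast
  then show ?case
    by (intro exI[of _ "inf z (if x \<in> T then x else - x)"])
      (simp add: z ultrafilter_simps)
qed

lemma type_element:
  assumes F: "finite (F :: 'a::boolean_algebra set)" and Z: "Z \<subseteq> Pow F"
  shows "\<exists>z. \<forall>u. ultrafilter u \<longrightarrow> (z \<in> u \<longleftrightarrow> u \<inter> F \<in> Z)"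
proof -
  have "finite Z" using F Z by (meson finite_Pow_iff finite_subset)
  then show ?thesis using Z
  proof (induction Z rule: finite_induct)
    case empty
    show ?case by (rule exI[of _ bot]) (auto simp: ultrafilter_simps)
  next
    case (insert T Z)
    then obtain z where z: "\<And>u. ultrafilter u \<Longrightarrow> z \<in> u \<longleftrightarrow> u \<inter> F \<in> Z" by auto
    obtain y where y: "\<And>u. ultrafilter u \<Longrightarrow> y \<in> u \<longleftrightarrow> u \<inter> F = T \<inter> F"
      using type_element_single[OF F] by blast
    have "T \<inter> F = T" using insert by auto
    then show ?case
      by (intro exI[of _ "sup y z"]) (auto simp: z y ultrafilter_simps)
  qed
qed

text \<open>An element contained in exactly those ultrafilters whose type over \<open>F\<close> belongs to
  \<open>Z\<close>.\<close>

definition type_join :: "'a::boolean_algebra set \<Rightarrow> 'a set set \<Rightarrow> 'a" where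
  "type_join F Z = (SOME z. \<forall>u. ultrafilter u \<longrightarrow> (z \<in> u \<longleftrightarrow> u \<inter> F \<in> Z))"

lemma type_join_iff:
  assumes "finite F" "Z \<subseteq> Pow F" "ultrafilter u"
  shows "type_join F Z \<in> u \<longleftrightarrow> u \<inter> F \<in> Z"
  using someI_ex[OF type_element[OF assms(1,2)]] assms(3) unfolding type_join_def by blast

text \<open>Given a map \<open>h\<close> on the algebra, \<open>types_below F h r\<close> is the set of the types
  that are covered after \<open>r\<close> rounds: a type gets covered as soon as one of its ultrafilters
  contains the image under \<open>h\<close> of the element \<open>stage F h r\<close> defining the types covered
  so far. The rank of an ultrafilter \<open>u\<close> is the first round in which it contains this image.
  Then \<open>types_below F h r\<close> consists of the types of the ultrafilters of rank less than
  \<open>r\<close> (lemma \<open>stage_rank\<close> in the locale below), while \<open>u\<close> itself may have a larger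
  rank than other ultrafilters of its type.\<close>

primrec types_below :: "'a::boolean_algebra set \<Rightarrow> ('a \<Rightarrow> 'a) \<Rightarrow> nat \<Rightarrow> 'a set set" where
  "types_below F h 0 = {}"
| "types_below F h (Suc r) =
     {u \<inter> F | u. ultrafilter u \<and> h (type_join F (types_below F h r)) \<in> u}"

definition stage :: "'a::boolean_algebra set \<Rightarrow> ('a \<Rightarrow> 'a) \<Rightarrow> nat \<Rightarrow> 'a" where
  "stage F h r = type_join F (types_below F h r)"

definition rank :: "'a::boolean_algebra set \<Rightarrow> ('a \<Rightarrow> 'a) \<Rightarrow> 'a set \<Rightarrow> nat" where
  "rank F h u = (LEAST r. h (stage F h r) \<in> u)"

lemma types_below_subset: "types_below F h r \<subseteq> Pow F"
  by (cases r) auto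

text \<open>If \<open>h\<close> is monotone and \<open>top\<close> is its only pre-fixpoint, every ultrafilter has a
  rank: the increasing sequence of stages becomes stationary because \<open>F\<close> has finitely many
  types, and its limit is a pre-fixpoint.\<close>

locale ranking =
  fixes F :: "'a::boolean_algebra set" and h :: "'a \<Rightarrow> 'a"
  assumes F: "finite F" and mono: "mono h" and prefix_top: "\<And>x. h x \<le> x \<Longrightarrow> x = top"
begin

lemma stage_iff: "ultrafilter u \<Longrightarrow> stage F h r \<in> u \<longleftrightarrow> u \<inter> F \<in> types_below F h r"
  unfolding stage_def by (rule type_join_iff[OF F types_below_subset])

lemma stage_mono_if: "types_below F h r \<subseteq> types_below F h s \<Longrightarrow> stage F h r \<le> stage F h s"
  by (rule le_by_ultrafilters) (auto simp: stage_iff)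

lemma types_below_Suc_stage:
  "types_below F h (Suc r) = {u \<inter> F | u. ultrafilter u \<and> h (stage F h r) \<in> u}"
  by (simp add: stage_def)

lemma types_below_Suc: "types_below F h r \<subseteq> types_below F h (Suc r)"
proof (induction r)
  case (Suc r)
  have "h (stage F h r) \<le> h (stage F h (Suc r))"
    using stage_mono_if[OF Suc] mono by (simp add: monoD)
  then show ?case
    unfolding types_below_Suc_stage using ultrafilter_mono by blast
qed simp

lemma h_stage_mono:
  assumes "r \<le> s" shows "h (stage F h r) \<le> h (stage F h s)"
proof -
  have "types_below F h r \<subseteq> types_below F h s"
    using types_below_Suc assms by (rule lift_Suc_mono_le)
  then show ?thesis using mono stage_mono_if by (simp add: monoD)
qed

lemma h_stage_exists: "\<exists>r. h (stage F h r) = top"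
proof -
  have "range (types_below F h) \<subseteq> Pow (Pow F)"
    using types_below_subset by blast
  then have fin: "finite (range (types_below F h))"
    using F by (meson finite_Pow_iff finite_subset)
  then have "\<not> inj (types_below F h)" by (meson finite_imageD infinite_UNIV_nat)
  then obtain r s where "r < s" "types_below F h r = types_below F h s"
    by (metis injI linorder_neqE_nat)
  then have eq: "types_below F h (Suc r) = types_below F h r"
    using lift_Suc_mono_le[of "types_below F h" "Suc r" s] types_below_Suc
    by (simp add: Suc_leI subset_antisym)
  have "h (stage F h r) \<le> stage F h r"
  proof (rule le_by_ultrafilters)
    fix u assume u: "ultrafilter u" "h (stage F h r) \<in> u"
    then have "u \<inter> F \<in> types_below F h (Suc r)" unfolding types_below_Suc_stage by blast
    then show "stage F h r \<in> u" using eq u stage_iff by auto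
  qed
  then have "stage F h r = top" by (rule prefix_top)
  moreover have "h top = top"
    by (rule prefix_top) (simp add: monoD[OF mono])
  ultimately show ?thesis by metis
qed

lemma rank_stage: "ultrafilter u \<Longrightarrow> h (stage F h (rank F h u)) \<in> u"
  unfolding rank_def using h_stage_exists ultrafilter_top by (metis LeastI)

lemma rank_le: "h (stage F h r) \<in> u \<Longrightarrow> rank F h u \<le> r"
  unfolding rank_def by (rule Least_le)

lemma stage_rank:
  assumes "ultrafilter u"
  shows "stage F h r \<in> u \<longleftrightarrow> (\<exists>w. ultrafilter w \<and> w \<inter> F = u \<inter> F \<and> rank F h w < r)"
proof (cases r)
  case 0
  then show ?thesis using assms stage_iff by auto
next
  case (Suc r')
  have below: "h (stage F h r') \<in> w \<longleftrightarrow> rank F h w < Suc r'" if "ultrafilter w" for w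
    using rank_le rank_stage[OF that] h_stage_mono ultrafilter_mono[OF that]
    by (metis less_Suc_eq_le)
  have "stage F h r \<in> u \<longleftrightarrow> (\<exists>w. u \<inter> F = w \<inter> F \<and> ultrafilter w \<and> h (stage F h r') \<in> w)"
    unfolding stage_iff[OF assms] Suc types_below_Suc_stage by blast
  then show ?thesis using below Suc by metis
qed

end

section \<open>The canonical frame\<close>

context ctlf_algebra
begin

lemma dia_mono: "a \<le> b \<Longrightarrow> dia a \<le> dia b"
  by (metis dia_sup sup.absorb_iff2 sup_ge1)

lemma eu_mono:
  assumes "a \<le> a'" "b \<le> b'" shows "eu a b \<le> eu a' b'"
proof (rule eu_least)
  have "sup a (inf b (dia (eu a' b'))) \<le> sup a' (inf b' (dia (eu a' b')))"
    using assms by (intro sup_mono inf_mono) auto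
  then show "sup a (inf b (dia (eu a' b'))) \<le> eu a' b'"
    using eu_prefix by (rule order_trans)
qed

lemma eu_unfold: "eu a b = sup a (inf b (dia (eu a b)))"
proof (rule antisym)
  show "eu a b \<le> sup a (inf b (dia (eu a b)))"
    by (rule eu_least) (meson dia_mono eu_prefix inf_mono order_refl sup_mono)
qed (rule eu_prefix)

text \<open>The accessibility relation of the canonical frame.\<close>

definition canon :: "('a set) rel" where
  "canon = {(u, v). ultrafilter u \<and> ultrafilter v \<and> (\<forall>c\<in>v. dia c \<in> u)}"

lemma canonD: "(u, v) \<in> canon \<Longrightarrow> c \<in> v \<Longrightarrow> dia c \<in> u"
  and canon_ultrafilter: "(u, v) \<in> canon \<Longrightarrow> ultrafilter u" "(u, v) \<in> canon \<Longrightarrow> ultrafilter v"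
  by (auto simp: canon_def)

lemma canon_witness:
  assumes u: "ultrafilter u" and c: "dia c \<in> u"
  obtains v where "(u, v) \<in> canon" "c \<in> v"
proof -
  \<comment> \<open>\<open>c\<close> together with all \<open>d\<close> whose box belongs to \<open>u\<close> generates a proper filter.\<close>
  define G where "G = {inf c d | d. - dia (- d) \<in> u}"
  have "bot \<notin> G"
  proof
    assume "bot \<in> G"
    then obtain d where d: "bot = inf c d" "- dia (- d) \<in> u" unfolding G_def by blast
    then have "dia c \<le> dia (- d)" by (intro dia_mono) (metis inf_shunt)
    then show False using u c d(2) ultrafilter_mono ultrafilter_compl by blast
  qed
  moreover have cG: "c \<in> G"
  proof -
    have "c = inf c top \<and> - dia (- top) \<in> u" using u by (simp add: dia_bot ultrafilter_simps)
    then show ?thesis unfolding G_def by blast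
  qed
  moreover have "inf x y \<in> G" if xy: "x \<in> G" "y \<in> G" for x y
  proof -
    obtain d e where d: "x = inf c d" "- dia (- d) \<in> u" and e: "y = inf c e" "- dia (- e) \<in> u"
      using xy unfolding G_def by blast
    have "inf x y = inf c (inf d e)" unfolding d e by (simp add: inf.left_commute inf.assoc)
    moreover have "- dia (- inf d e) \<in> u"
      using d e u by (simp add: dia_sup ultrafilter_simps)
    ultimately show ?thesis unfolding G_def by blast
  qed
  ultimately obtain v where v: "ultrafilter v" "G \<subseteq> v"
    using ultrafilter_extension[of G] by blast
  have "dia e \<in> u" if "e \<in> v" for e
  proof (rule ccontr)
    assume "dia e \<notin> u"
    then have "- dia (- (- e)) \<in> u" using u by (simp add: ultrafilter_simps)
    then have "inf c (- e) \<in> G" unfolding G_def by blast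
    then show False using v that by (auto simp: ultrafilter_simps)
  qed
  then show thesis using that v u cG by (auto simp: canon_def)
qed

lemma canon_serial:
  assumes "ultrafilter u" obtains v where "(u, v) \<in> canon"
  using assms canon_witness[of u top] by (metis dia_top ultrafilter_top)

end

section \<open>Tasks and their ranks\<close>

text \<open>\<open>Next c\<close> stands for the obligation to interpret \<open>dia c\<close> correctly where it holds,
  \<open>Reach a b\<close> likewise for \<open>eu a b\<close>, and \<open>Avoid a b\<close> for the obligation to make
  \<open>eg a b\<close> false where it does not hold.\<close>

datatype 'a task = Next 'a | Reach 'a 'a | Avoid 'a 'a

context ctlf_algebra
begin

text \<open>The maps from which ranks are obtained. For \<open>Reach a b\<close>, the element \<open>advance i x\<close>
  says that the task is over, or that \<open>b\<close> holds and some successor satisfies \<open>x\<close> while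
  \<open>eu a b\<close> is still in force. For \<open>Avoid a b\<close>, it says that the task is over, or that
  after the present step \<open>b\<close> is met within \<open>x\<close> only, as long as \<open>a\<close> holds. The
  task \<open>Next c\<close> is settled in a single step and needs no rank.\<close>

primrec advance :: "'a task \<Rightarrow> 'a \<Rightarrow> 'a" where
  "advance (Next c) x = top"
| "advance (Reach a b) x = sup (- eu a b) (sup a (inf b (dia (inf (eu a b) x))))"
| "advance (Avoid a b) x = sup (eg a b) (sup (- a) (- dia (eu (inf b (- x)) a)))"

lemma mono_advance: "mono (advance i)"
proof (rule monoI)
  fix x y :: 'a assume "x \<le> y"
  then show "advance i x \<le> advance i y"
  proof (cases i)
    case (Reach a b)
    have "dia (inf (eu a b) x) \<le> dia (inf (eu a b) y)"
      using \<open>x \<le> y\<close> by (intro dia_mono inf_mono) auto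
    then show ?thesis unfolding Reach advance.simps by (intro sup_mono inf_mono order_refl)
  next
    case (Avoid a b)
    have "dia (eu (inf b (- y)) a) \<le> dia (eu (inf b (- x)) a)"
      using \<open>x \<le> y\<close> by (intro dia_mono eu_mono inf_mono) auto
    then show ?thesis unfolding Avoid advance.simps by (intro sup_mono order_refl compl_mono)
  qed simp
qed

text \<open>For \<open>Reach a b\<close>, a pre-fixpoint \<open>x\<close> makes \<open>inf (eu a b) x\<close> a pre-fixpoint of
  the map defining \<open>eu a b\<close>; for \<open>Avoid a b\<close>, it makes \<open>- x\<close> a post-fixpoint of
  the map defining \<open>eg a b\<close>.\<close>

lemma advance_prefix_top:
  assumes le: "advance i x \<le> x"
  shows "x = top"
proof (cases i)
  case (Next c)
  then show ?thesis using le by (simp add: top_unique)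
next
  case (Reach a b)
  let ?f = "eu a b"
  have 1: "- ?f \<le> x" "a \<le> x" "inf b (dia (inf ?f x)) \<le> x"
    using le Reach by auto
  have "inf b (dia (inf ?f x)) \<le> inf b (dia ?f)"
    by (rule inf_mono[OF order_refl dia_mono]) simp
  moreover have 2: "inf b (dia ?f) \<le> ?f" "a \<le> ?f"
    using eu_prefix[of a b] by auto
  ultimately have 3: "inf b (dia (inf ?f x)) \<le> ?f"
    by (meson order_trans)
  then have "?f \<le> inf ?f x"
    using 1 2 3 by (intro eu_least le_infI le_supI) auto
  then have "?f \<le> x" by simp
  then have "sup ?f (- ?f) \<le> x" using 1(1) by (rule le_supI)
  then show ?thesis by (simp add: top_unique)
next
  case (Avoid a b)
  have 1: "eg a b \<le> x" "- a \<le> x" "- dia (eu (inf b (- x)) a) \<le> x"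
    using le Avoid by auto
  then have "- x \<le> a" "- x \<le> dia (eu (inf b (- x)) a)"
    by (metis compl_le_swap2)+
  then have "- x \<le> eg a b" by (intro eg_greatest) auto
  then have "- x \<le> x" using 1(1) by (rule order_trans)
  then have "sup x (- x) \<le> x" by (intro le_supI order_refl)
  then show ?thesis by (simp add: top_unique)
qed

lemma ranking_advance: "finite F \<Longrightarrow> ranking F (advance i)"
  by (simp add: ranking.intro mono_advance advance_prefix_top)

abbreviation trank :: "'a set \<Rightarrow> 'a task \<Rightarrow> 'a set \<Rightarrow> nat" where
  "trank F i \<equiv> rank F (advance i)"

lemma Reach_rank:
  assumes F: "finite F" and u: "ultrafilter u" "eu a b \<in> u" "a \<notin> u"
  obtains v w where "(u, v) \<in> canon" "eu a b \<in> v" "ultrafilter w" "w \<inter> F = v \<inter> F"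
    "trank F (Reach a b) w < trank F (Reach a b) u"
proof -
  interpret ranking F "advance (Reach a b)" by (rule ranking_advance[OF F])
  let ?x = "stage F (advance (Reach a b)) (trank F (Reach a b) u)"
  have "dia (inf (eu a b) ?x) \<in> u"
    using rank_stage[OF u(1)] u by (simp add: ultrafilter_simps)
  then obtain v where v: "(u, v) \<in> canon" "inf (eu a b) ?x \<in> v"
    using canon_witness u(1) by blast
  then have "ultrafilter v" by (simp add: canon_def)
  then show thesis using that v stage_rank by (simp add: ultrafilter_simps) blast
qed

lemma Avoid_rank:
  assumes F: "finite F" and uv: "(u, v) \<in> canon" and u: "eg a b \<notin> u" "a \<in> u"
  shows "(\<exists>w. ultrafilter w \<and> w \<inter> F = v \<inter> F \<and> trank F (Avoid a b) w < trank F (Avoid a b) u) \<or>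
    b \<notin> v \<and> trank F (Avoid a b) v \<le> trank F (Avoid a b) u"
proof -
  interpret ranking F "advance (Avoid a b)" by (rule ranking_advance[OF F])
  let ?r = "trank F (Avoid a b) u"
  let ?x = "stage F (advance (Avoid a b)) ?r"
  let ?y = "eu (inf b (- ?x)) a"
  have uu: "ultrafilter u" and vv: "ultrafilter v" using uv by (auto simp: canon_def)
  \<comment> \<open>\<open>?y\<close>: some path leads to \<open>b\<close> outside \<open>?x\<close>, with \<open>a\<close> holding on the way.\<close>
  have "dia ?y \<notin> u"
    using rank_stage[OF uu] u uu by (simp add: ultrafilter_simps)
  then have y: "?y \<notin> v" using uv canonD by blast
  have y_unfold: "?y \<in> v \<longleftrightarrow> inf b (- ?x) \<in> v \<or> a \<in> v \<and> dia ?y \<in> v"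
    by (subst eu_unfold) (simp add: ultrafilter_simps vv)
  show ?thesis
  proof (cases "b \<in> v")
    case True
    then have "?x \<in> v" using y y_unfold vv by (simp add: ultrafilter_simps)
    then show ?thesis using stage_rank[OF vv] by blast
  next
    case False
    have "advance (Avoid a b) ?x \<in> v" using y y_unfold vv by (auto simp: ultrafilter_simps)
    then show ?thesis using False rank_le by blast
  qed
qed

lemma eg_unfold_in:
  assumes "ultrafilter u"
  shows "eg a b \<in> u \<Longrightarrow> a \<in> u" "eg a b \<in> u \<Longrightarrow> dia (eu (inf b (eg a b)) a) \<in> u"
  using eg_postfix[of a b] ultrafilter_mono[OF assms] by auto

lemma eu_unfold_in:
  assumes "ultrafilter u"
  shows "eu a b \<in> u \<longleftrightarrow> a \<in> u \<or> b \<in> u \<and> dia (eu a b) \<in> u"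
  using assms by (subst eu_unfold) (simp add: ultrafilter_simps)

text \<open>The element \<open>inf a (dia (eu (inf b (eg a b)) a))\<close>, which lies above \<open>eg a b\<close>, is a
  post-fixpoint as well, hence equal to \<open>eg a b\<close>.\<close>

lemma eg_backward:
  assumes uv: "(u, v) \<in> canon" and "a \<in> u" "eg a b \<in> v"
  shows "eg a b \<in> u"
proof -
  let ?e = "eg a b"
  let ?f = "eu (inf b ?e) a"
  have "?e \<le> ?f"
    using eg_postfix[of a b] eu_prefix[of "inf b ?e" a] by (meson le_sup_iff order_trans)
  then have "?f \<in> v" using assms(3) canon_ultrafilter(2)[OF uv] ultrafilter_mono by blast
  then have "inf a (dia ?f) \<in> u"
    using assms(2) canonD[OF uv] canon_ultrafilter(1)[OF uv] by (simp add: ultrafilter_inf)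
  moreover have "inf a (dia ?f) \<le> ?e"
  proof (rule eg_greatest)
    have *: "?f \<le> eu (inf b (inf a (dia ?f))) a"
      by (intro eu_mono inf_mono eg_postfix) auto
    have "dia ?f \<le> dia (eu (inf b (inf a (dia ?f))) a)"
      by (rule dia_mono[OF *])
    then show "inf a (dia ?f) \<le> inf a (dia (eu (inf b (inf a (dia ?f))) a))"
      by (intro inf_mono) auto
  qed
  ultimately show ?thesis using canon_ultrafilter(1)[OF uv] ultrafilter_mono by blast
qed

end

section \<open>Priority lists\<close>

text \<open>Move the first element satisfying \<open>D\<close>, if any, to the end of the list.\<close>

primrec defer_first :: "('b \<Rightarrow> bool) \<Rightarrow> 'b list \<Rightarrow> 'b list" where
  "defer_first D [] = []"
| "defer_first D (x # xs) = (if D x then xs @ [x] else x # defer_first D xs)"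

lemma set_defer_first: "set (defer_first D xs) = set xs"
  by (induction xs) auto

lemma distinct_defer_first: "distinct (defer_first D xs) = distinct xs"
  by (induction xs) (auto simp: set_defer_first)

lemma defer_first_append_none:
  "\<forall>x\<in>set zs. \<not> D x \<Longrightarrow> defer_first D (zs @ ys) = zs @ defer_first D ys"
  by (induction zs) auto

lemma defer_first_append_some:
  "\<exists>x\<in>set zs. D x \<Longrightarrow> \<exists>zs' ys'. defer_first D (zs @ ys) = zs' @ ys @ ys' \<and>
     length zs' < length zs"
proof (induction zs)
  case (Cons z zs)
  show ?case
  proof (cases "D z")
    case False
    then obtain zs' ys' where "defer_first D (zs @ ys) = zs' @ ys @ ys'"
      "length zs' < length zs" using Cons by auto
    then show ?thesis using False by (intro exI[of _ "z # zs'"] exI[of _ ys']) auto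
  qed auto
qed simp

text \<open>The position of an element that is no longer moved never increases, and it decreases whenever an
  element in front of it is moved. Once the position is minimal, nothing in front of the element is
  ever moved again.\<close>

lemma prefix_eventually_constant:
  fixes \<pi> :: "nat \<Rightarrow> 'b list"
  assumes step: "\<And>t. \<pi> (Suc t) = defer_first (D t) (\<pi> t)"
    and g: "g \<in> set (\<pi> 0)" and undone: "\<And>t. t \<ge> t\<^sub>1 \<Longrightarrow> \<not> D t g"
  obtains t\<^sub>2 zs where "t\<^sub>2 \<ge> t\<^sub>1" "\<And>t. t \<ge> t\<^sub>2 \<Longrightarrow> \<exists>ys. \<pi> t = zs @ g # ys"
    "\<And>t x. t \<ge> t\<^sub>2 \<Longrightarrow> x \<in> set zs \<Longrightarrow> \<not> D t x"
proof -
  \<comment> \<open>\<open>pre n t\<close>: at time \<open>t\<close> the element \<open>g\<close> has \<open>n\<close> predecessors.\<close>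
  define pre where "pre n t \<longleftrightarrow> t \<ge> t\<^sub>1 \<and> (\<exists>zs ys. \<pi> t = zs @ g # ys \<and> length zs = n)" for n t
  have "g \<in> set (\<pi> t)" for t
    by (induction t) (auto simp: step g set_defer_first)
  then have "\<exists>n t. pre n t"
    unfolding pre_def by (metis order_refl split_list)
  then obtain n where "\<exists>t. pre n t" and least: "\<And>m. m < n \<Longrightarrow> \<nexists>t. pre m t"
    using exists_least_iff[of "\<lambda>n. \<exists>t. pre n t"] by blast
  then obtain t\<^sub>2 zs ys where t2: "t\<^sub>2 \<ge> t\<^sub>1" "\<pi> t\<^sub>2 = zs @ g # ys" "length zs = n"
    unfolding pre_def by blast
  have undone_zs: "\<not> D t x" if t: "t \<ge> t\<^sub>2" and eq: "\<pi> t = zs @ g # ys'" and "x \<in> set zs" for t x ys'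
  proof
    assume "D t x"
    then have "\<exists>x\<in>set zs. D t x" using that by blast
    then obtain zs' ys'' where "\<pi> (Suc t) = zs' @ (g # ys') @ ys''" "length zs' < n"
      using defer_first_append_some[of zs "D t" "g # ys'"] unfolding step eq t2(3)[symmetric] by metis
    then have "pre (length zs') (Suc t)" using that t2 by (auto simp: pre_def)
    then show False using least \<open>length zs' < n\<close> by blast
  qed
  have const: "\<exists>ys. \<pi> t = zs @ g # ys" if "t \<ge> t\<^sub>2" for t
    using that
  proof (induction t rule: dec_induct)
    case base
    then show ?case using t2 by blast
  next
    case (step t)
    then obtain ys where ys: "\<pi> t = zs @ g # ys" by blast
    have "\<pi> (Suc t) = zs @ defer_first (D t) (g # ys)"
      unfolding assms(1) ys using undone_zs[OF step(1) ys] by (intro defer_first_append_none) auto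
    then show ?case using undone[of t] step t2 by simp
  qed
  show thesis using that[OF t2(1) const] undone_zs const by blast
qed

lemma decreasing_nat_eventually_constant:
  fixes f :: "nat \<Rightarrow> nat"
  assumes "\<And>t. t \<ge> t\<^sub>0 \<Longrightarrow> f (Suc t) \<le> f t"
  obtains t\<^sub>1 where "t\<^sub>1 \<ge> t\<^sub>0" "\<And>t. t \<ge> t\<^sub>1 \<Longrightarrow> f (Suc t) = f t"
proof -
  obtain t\<^sub>1 where t1: "t\<^sub>1 \<ge> t\<^sub>0" "\<And>t. t \<ge> t\<^sub>0 \<Longrightarrow> f t\<^sub>1 \<le> f t"
    using ex_has_least_nat[of "\<lambda>t. t \<ge> t\<^sub>0" t\<^sub>0 f] by blast
  have const: "f t = f t\<^sub>1" if "t \<ge> t\<^sub>1" for t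
    using that
  proof (induction t rule: dec_induct)
    case (step t)
    then show ?case using assms[of t] t1(1) t1(2)[of "Suc t"] by simp
  qed simp
  have "f (Suc t) = f t" if "t \<ge> t\<^sub>1" for t
    using const[of t] const[of "Suc t"] that by simp
  then show thesis using that t1(1) by blast
qed

section \<open>The strategy\<close>

text \<open>The elements whose membership is passed on unchanged from the chosen successor to the ultrafilter
  that replaces it.\<close>

primrec watched :: "('a::boolean_algebra \<Rightarrow> 'a \<Rightarrow> 'a) \<Rightarrow> ('a \<Rightarrow> 'a \<Rightarrow> 'a) \<Rightarrow> 'a task \<Rightarrow> 'a set" where
  "watched eu eg (Next c) = {c}"
| "watched eu eg (Reach a b) = {eu a b}"
| "watched eu eg (Avoid a b) = {b, eg a b}"

locale strategy = ctlf_algebra dia eu eg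
  for dia :: "'a::boolean_algebra \<Rightarrow> 'a" and eu eg +
  fixes I :: "'a task set"
  assumes finite_tasks: "finite I"
begin

text \<open>\<open>level j\<close> determines the types used at position \<open>j\<close> of the priority list. The next
  level contains all elements \<open>advance i (stage (level j) (advance i) r)\<close>, so that the ranks over
  \<open>level j\<close> depend on the type over \<open>level (Suc j)\<close> only.\<close>

primrec level :: "nat \<Rightarrow> 'a set" where
  "level 0 = (\<Union>i\<in>I. watched eu eg i)"
| "level (Suc j) = level j \<union> (\<Union>i\<in>I. (\<lambda>Z. advance i (type_join (level j) Z)) ` Pow (Pow (level j)))"

lemma finite_level: "finite (level j)"
proof (induction j)
  case 0
  have "finite (watched eu eg i)" for i by (cases i) auto
  then show ?case using finite_tasks by simp
qed (simp add: finite_tasks)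

lemma level_mono: "i \<le> j \<Longrightarrow> level i \<subseteq> level j"
  by (rule lift_Suc_mono_le[of level]) auto

abbreviation same :: "nat \<Rightarrow> 'a set \<Rightarrow> 'a set \<Rightarrow> bool" where
  "same j u v \<equiv> u \<inter> level j = v \<inter> level j"

lemma same_mono: "same j u v \<Longrightarrow> i \<le> j \<Longrightarrow> same i u v"
  using level_mono[of i j] by blast

lemma same_level_0: "same j u v \<Longrightarrow> i \<in> I \<Longrightarrow> c \<in> watched eu eg i \<Longrightarrow> c \<in> u \<longleftrightarrow> c \<in> v"
  using same_mono[of u j v 0] by auto

text \<open>The rank for the task \<open>i\<close> when it is at position \<open>j\<close> of the priority list.\<close>

definition rk :: "nat \<Rightarrow> 'a task \<Rightarrow> 'a set \<Rightarrow> nat" where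
  "rk j i = rank (level j) (advance i)"

lemma rk_cong:
  assumes "i \<in> I" "same (Suc j) u v"
  shows "rk j i u = rk j i v"
proof -
  have "advance i (stage (level j) (advance i) r) \<in> level (Suc j)" for r
    using assms(1) types_below_subset[of "level j" "advance i" r] by (auto simp: stage_def)
  then have "advance i (stage (level j) (advance i) r) \<in> u \<longleftrightarrow>
      advance i (stage (level j) (advance i) r) \<in> v" for r
    using assms(2) by blast
  then show ?thesis by (simp add: rk_def rank_def)
qed

text \<open>The rank of \<open>u\<close> is minimal among the ultrafilters of its type.\<close>

definition settled :: "nat \<Rightarrow> 'a task \<Rightarrow> 'a set \<Rightarrow> bool" where
  "settled j i u \<longleftrightarrow> (\<forall>w. ultrafilter w \<and> same j w u \<longrightarrow> rk j i u \<le> rk j i w)"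

lemma settled_cong:
  assumes "i \<in> I" "same (Suc j) u v"
  shows "settled j i u \<longleftrightarrow> settled j i v"
  using rk_cong[OF assms] same_mono[OF assms(2), of j] by (simp add: settled_def)

lemma settle_one:
  assumes "ultrafilter u"
  obtains w where "ultrafilter w" "same j w u" "settled j i w"
proof -
  obtain w where "ultrafilter w \<and> same j w u"
    and "\<forall>x. ultrafilter x \<and> same j x u \<longrightarrow> rk j i w \<le> rk j i x"
    using ex_has_least_nat[of "\<lambda>w. ultrafilter w \<and> same j w u" u "rk j i"] assms by blast
  then show thesis using that[of w] unfolding settled_def by simp
qed

text \<open>\<open>u\<close> is a replacement of \<open>v\<close> which is settled at every position of the list
  \<open>\<pi>\<close>, and which has the type of \<open>v\<close> over every level \<open>j\<close> such that \<open>v\<close>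
  itself is settled at all positions before \<open>j\<close>. In particular it always has the type of
  \<open>v\<close> over \<open>level 0\<close>.\<close>

definition settlement :: "'a task list \<Rightarrow> 'a set \<Rightarrow> 'a set \<Rightarrow> bool" where
  "settlement \<pi> v u \<longleftrightarrow> ultrafilter u \<and> (\<forall>j<length \<pi>. settled j (\<pi> ! j) u) \<and>
     (\<forall>j\<le>length \<pi>. (\<forall>i<j. settled i (\<pi> ! i) v) \<longrightarrow> same j u v)"

text \<open>The positions are settled in order of increasing index. Settling position \<open>m\<close> keeps the type
  over \<open>level m\<close>, so that the smaller positions stay settled.\<close>

lemma settlement_exists:
  assumes "set \<pi> \<subseteq> I" "ultrafilter v"
  shows "\<exists>u. settlement \<pi> v u"
proof -
  have "\<exists>u. ultrafilter u \<and> (\<forall>j<m. settled j (\<pi> ! j) u) \<and>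
     (\<forall>j\<le>length \<pi>. (\<forall>i<j. settled i (\<pi> ! i) v) \<longrightarrow> same j u v)" if "m \<le> length \<pi>" for m
    using that
  proof (induction m)
    case 0
    then show ?case using assms(2) by blast
  next
    case (Suc m)
    then obtain u where u: "ultrafilter u" "\<And>j. j < m \<Longrightarrow> settled j (\<pi> ! j) u"
      and agree: "\<And>j. j \<le> length \<pi> \<Longrightarrow> (\<And>i. i < j \<Longrightarrow> settled i (\<pi> ! i) v) \<Longrightarrow> same j u v"
      by auto
    have mem: "\<pi> ! j \<in> I" if "j \<le> m" for j
      using assms(1) nth_mem[of j \<pi>] that Suc.prems by auto
    \<comment> \<open>An ultrafilter already settled at \<open>m\<close> must be kept, to agree with \<open>v\<close> on higher levels.\<close>
    show ?case
    proof (cases "settled m (\<pi> ! m) u")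
      case True
      then show ?thesis using u agree by (metis less_Suc_eq)
    next
      case False
      obtain w where w: "ultrafilter w" "same m w u" "settled m (\<pi> ! m) w"
        using settle_one u(1) by blast
      have "settled j (\<pi> ! j) w" if "j < Suc m" for j
      proof (cases "j = m")
        case False
        then have "j < m" using that by simp
        then show ?thesis
          using u(2) settled_cong[of "\<pi> ! j" w j u, OF mem] same_mono[OF w(2), of "Suc j"] by simp
      qed (use w in simp)
      moreover have "same j w v"
        if j: "j \<le> length \<pi>" "\<And>i. i < j \<Longrightarrow> settled i (\<pi> ! i) v" for j
      proof -
        have uv: "same j u v" using agree j by blast
        have "j \<le> m"
        proof (rule ccontr)
          assume "\<not> j \<le> m"
          then have "settled m (\<pi> ! m) v" "same (Suc m) u v"
            using j(2) same_mono[OF uv, of "Suc m"] by auto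
          then show False using False settled_cong[OF mem] by blast
        qed
        then show ?thesis using same_mono[OF w(2)] uv by metis
      qed
      ultimately show ?thesis using w(1) by blast
    qed
  qed
  from this[of "length \<pi>"] show ?thesis unfolding settlement_def by blast
qed

text \<open>\<open>discharged k u i\<close>: passing from \<open>u\<close> to the child that serves the task \<open>k\<close>
  discharges the task \<open>i\<close>. The task \<open>Reach a b\<close> has one child of its own; on the way to
  any other child it is given up.\<close>

primrec discharged :: "'a task \<Rightarrow> 'a set \<Rightarrow> 'a task \<Rightarrow> bool" where
  "discharged k u (Next c) \<longleftrightarrow> True"
| "discharged k u (Reach a b) \<longleftrightarrow> eu a b \<notin> u \<or> a \<in> u \<or> k \<noteq> Reach a b"
| "discharged k u (Avoid a b) \<longleftrightarrow> eg a b \<in> u \<or> a \<notin> u"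

text \<open>\<open>v\<close> is a successor of \<open>u\<close> suitable for the child that serves the task \<open>k\<close>, when
  the priority list is \<open>\<pi>\<close>. For a \<open>Reach\<close> task still to be fulfilled, the type of
  \<open>v\<close> at the position of the task has to admit a smaller rank than that of \<open>u\<close>. A
  successor for an \<open>Avoid\<close> task is arbitrary.\<close>

definition serves :: "'a task \<Rightarrow> 'a set \<Rightarrow> 'a task list \<Rightarrow> 'a set \<Rightarrow> bool" where
  "serves k u \<pi> v \<longleftrightarrow> (u, v) \<in> canon \<and>
     (\<forall>c. k = Next c \<longrightarrow> dia c \<in> u \<longrightarrow> c \<in> v) \<and>
     (\<forall>a b. k = Reach a b \<longrightarrow> eu a b \<in> u \<longrightarrow> a \<notin> u \<longrightarrow> eu a b \<in> v \<and>
       (\<forall>j<length \<pi>. \<pi> ! j = k \<longrightarrow> (\<exists>w. ultrafilter w \<and> same j w v \<and> rk j k w < rk j k u)))"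

lemma serves_exists:
  assumes u: "ultrafilter u" and "distinct \<pi>"
  shows "\<exists>v. serves k u \<pi> v"
proof -
  obtain v\<^sub>0 where v0: "(u, v\<^sub>0) \<in> canon" using canon_serial[OF u] .
  show ?thesis
  proof (cases k)
    case k: (Next c)
    show ?thesis
    proof (cases "dia c \<in> u")
      case True
      then obtain v where "(u, v) \<in> canon" "c \<in> v" using canon_witness[OF u] by blast
      then have "serves k u \<pi> v" by (simp add: serves_def k)
      then show ?thesis by blast
    next
      case False
      then have "serves k u \<pi> v\<^sub>0" using v0 by (simp add: serves_def k)
      then show ?thesis by blast
    qed
  next
    case (Avoid a b)
    then have "serves k u \<pi> v\<^sub>0" using v0 by (simp add: serves_def)
    then show ?thesis by blast
  next
    case k: (Reach a b)
    show ?thesis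
    proof (cases "eu a b \<in> u \<and> a \<notin> u")
      case True
      define j where "j = (SOME j. j < length \<pi> \<and> \<pi> ! j = k)"
      obtain v w where vw: "(u, v) \<in> canon" "eu a b \<in> v" "ultrafilter w" "same j w v"
        "rk j k w < rk j k u"
        using Reach_rank[OF finite_level u] True unfolding rk_def k by metis
      have "j' = j" if j': "j' < length \<pi>" "\<pi> ! j' = k" for j'
      proof -
        have "j < length \<pi> \<and> \<pi> ! j = k"
          unfolding j_def by (rule someI[of _ j']) (simp add: j')
        then show ?thesis using j' assms(2) nth_eq_iff_index_eq[of \<pi> j' j] by simp
      qed
      then have "serves k u \<pi> v" unfolding serves_def using vw k by blast
      then show ?thesis by blast
    next
      case False
      then have "serves k u \<pi> v\<^sub>0" using v0 by (simp add: serves_def k)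
      then show ?thesis by blast
    qed
  qed
qed

text \<open>A state consists of an ultrafilter and a priority list of the tasks. In a step to the child that
  serves \<open>k\<close>, the list is updated and a suitable successor is replaced by a settled
  ultrafilter.\<close>

definition step :: "'a task \<Rightarrow> 'a set \<times> 'a task list \<Rightarrow> 'a set \<times> 'a task list \<Rightarrow> bool" where
  "step k s s' \<longleftrightarrow> snd s' = defer_first (discharged k (fst s)) (snd s) \<and>
     (\<exists>v. serves k (fst s) (snd s) v \<and> settlement (snd s') v (fst s'))"

definition state :: "'a set \<times> 'a task list \<Rightarrow> bool" where
  "state s \<longleftrightarrow> ultrafilter (fst s) \<and> distinct (snd s) \<and> set (snd s) = I"

lemma step_exists:
  assumes "state s"
  shows "\<exists>s'. step k s s'"
proof -
  let ?\<pi> = "defer_first (discharged k (fst s)) (snd s)"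
  obtain v where "serves k (fst s) (snd s) v"
    using assms serves_exists unfolding state_def by blast
  moreover from this obtain u where "settlement ?\<pi> v u"
    using settlement_exists[of ?\<pi> v] assms canon_ultrafilter
    by (auto simp: state_def set_defer_first serves_def)
  ultimately have "step k s (u, ?\<pi>)" by (auto simp: step_def)
  then show ?thesis by blast
qed

lemma step_state: "state s \<Longrightarrow> step k s s' \<Longrightarrow> state s'"
  by (auto simp: state_def step_def settlement_def set_defer_first distinct_defer_first)

lemma stepE:
  assumes "step k s s'"
  obtains v where "(fst s, v) \<in> canon" "serves k (fst s) (snd s) v" "same 0 (fst s') v"
    "settlement (snd s') v (fst s')"
  using assms unfolding step_def serves_def settlement_def by blast

lemma step_Next:
  assumes "step (Next c) s s'" "Next c \<in> I" "dia c \<in> fst s"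
  shows "c \<in> fst s'"
proof -
  obtain v where v: "serves (Next c) (fst s) (snd s) v" "same 0 (fst s') v"
    using assms(1) by (rule stepE)
  have "c \<in> v" using v(1) assms(3) by (simp add: serves_def)
  then show ?thesis using same_level_0[OF v(2) assms(2), of c] by simp
qed

lemma step_dia:
  assumes "step k s s'" "Next c \<in> I" "c \<in> fst s'"
  shows "dia c \<in> fst s"
proof -
  obtain v where "(fst s, v) \<in> canon" "same 0 (fst s') v" using assms(1) by (rule stepE)
  moreover from this have "c \<in> v" using same_level_0[OF _ assms(2), of "fst s'" 0 v c] assms(3) by simp
  ultimately show ?thesis using canonD by blast
qed

lemma step_Reach:
  assumes "step (Reach a b) s s'" "Reach a b \<in> I" "eu a b \<in> fst s" "a \<notin> fst s"
  shows "eu a b \<in> fst s'"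
proof -
  obtain v where v: "serves (Reach a b) (fst s) (snd s) v" "same 0 (fst s') v"
    using assms(1) by (rule stepE)
  have "eu a b \<in> v" using v(1) assms(3,4) by (simp add: serves_def)
  then show ?thesis using same_level_0[OF v(2) assms(2), of "eu a b"] by simp
qed

lemma step_eu:
  assumes "step k s s'" "Reach a b \<in> I" "eu a b \<in> fst s'" "b \<in> fst s"
  shows "eu a b \<in> fst s"
proof -
  obtain v where v: "(fst s, v) \<in> canon" "same 0 (fst s') v" using assms(1) by (rule stepE)
  have "eu a b \<in> v" using same_level_0[OF v(2) assms(2), of "eu a b"] assms(3) by simp
  then show ?thesis using canonD[OF v(1)] assms(4) eu_unfold_in[OF canon_ultrafilter(1)[OF v(1)]] by blast
qed

lemma step_eg:
  assumes "step k s s'" "Avoid a b \<in> I" "eg a b \<in> fst s'" "a \<in> fst s"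
  shows "eg a b \<in> fst s"
proof -
  obtain v where v: "(fst s, v) \<in> canon" "same 0 (fst s') v" using assms(1) by (rule stepE)
  have "eg a b \<in> v" using same_level_0[OF v(2) assms(2), of "eg a b"] assms(3) by simp
  then show ?thesis using eg_backward[OF v(1) assms(4)] by blast
qed

text \<open>A step that neither discharges the task \<open>i\<close> at position \<open>j\<close> nor changes the list up to
  this position, and whose successor \<open>v\<close> is settled before \<open>j\<close>, does not increase the
  rank of \<open>i\<close>. If the rank stays the same, then \<open>v\<close> is settled at \<open>j\<close>, too, which
  allows the same argument at the next position.\<close>

lemma step_rank:
  assumes step: "step k s s'" and j: "j < length (snd s)" "snd s ! j = i" "i \<in> I"
    and len: "j < length (snd s')" and nd: "\<not> discharged k (fst s) i"
    and same_pos: "\<And>m. m \<le> j \<Longrightarrow> snd s' ! m = snd s ! m"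
    and v: "settlement (snd s') v (fst s')" "serves k (fst s) (snd s) v"
    and prev: "\<And>m. m < j \<Longrightarrow> settled m (snd s ! m) v"
  shows "rk j i (fst s') \<le> rk j i (fst s)"
    and "rk j i (fst s') = rk j i (fst s) \<Longrightarrow> settled j i v \<and> (\<exists>a b. i = Avoid a b \<and> b \<notin> fst s')"
proof -
  let ?u = "fst s" and ?u' = "fst s'"
  have uv: "(?u, v) \<in> canon" using v(2) by (simp add: serves_def)
  have vu': "same j ?u' v" using v(1) prev same_pos len unfolding settlement_def
    by (metis less_imp_le)
  have settled: "settled j i ?u'" using v(1) len same_pos[of j] j by (auto simp: settlement_def)
  have low: "rk j i ?u' \<le> rk j i w" if "ultrafilter w" "same j w v" for w
    using settled that vu' unfolding settled_def by metis
  have "rk j i ?u' < rk j i ?u \<or> (rk j i v \<le> rk j i ?u \<and> (\<exists>a b. i = Avoid a b \<and> b \<notin> ?u'))"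
  proof (cases i)
    case (Reach a b)
    then have "\<exists>w. ultrafilter w \<and> same j w v \<and> rk j i w < rk j i ?u"
      using v(2) j nd by (auto simp: serves_def)
    then show ?thesis using low by (meson le_less_trans)
  next
    case (Avoid a b)
    have b: "b \<in> ?u' \<longleftrightarrow> b \<in> v" using same_level_0[OF vu', of i b] j Avoid by simp
    have "(\<exists>w. ultrafilter w \<and> same j w v \<and> rk j i w < rk j i ?u) \<or> b \<notin> v \<and> rk j i v \<le> rk j i ?u"
      using Avoid_rank[OF finite_level uv] nd unfolding Avoid rk_def by simp
    then show ?thesis
    proof
      assume "b \<notin> v \<and> rk j i v \<le> rk j i ?u"
      then show ?thesis using b Avoid by blast
    next
      assume "\<exists>w. ultrafilter w \<and> same j w v \<and> rk j i w < rk j i ?u"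
      then show ?thesis using low by (meson le_less_trans)
    qed
  qed (use nd in simp)
  moreover have "rk j i ?u' \<le> rk j i v" using low uv canon_ultrafilter by blast
  moreover have "settled j i v" if "rk j i v \<le> rk j i ?u'"
    using low that unfolding settled_def by (meson order_trans)
  ultimately show "rk j i ?u' \<le> rk j i ?u"
    "rk j i ?u' = rk j i ?u \<Longrightarrow> settled j i v \<and> (\<exists>a b. i = Avoid a b \<and> b \<notin> ?u')"
    by auto
qed

section \<open>Runs of the strategy\<close>

text \<open>A run is a sequence of consecutive states; \<open>k t\<close> is the task served in the step from
  \<open>s t\<close> to \<open>s (Suc t)\<close>.\<close>

definition run :: "(nat \<Rightarrow> 'a set \<times> 'a task list) \<Rightarrow> (nat \<Rightarrow> 'a task) \<Rightarrow> bool" where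
  "run s k \<longleftrightarrow> state (s 0) \<and> (\<forall>t. step (k t) (s t) (s (Suc t)))"

lemma run_state: "run s k \<Longrightarrow> state (s t)"
  by (induction t) (auto simp: run_def intro: step_state)

text \<open>A task that from some time on is never discharged is an \<open>Avoid\<close> task, and its second argument
  is met finitely often. The proof shows by induction on the positions \<open>j\<close> up to that of the
  task, once this part of the list does not change any more, that the rank at \<open>j\<close> is eventually
  constant and that the successors are eventually settled at \<open>j\<close>.\<close>

lemma run_undischarged:
  assumes run: "run s k" and g: "g \<in> I" and undone: "\<And>t. t \<ge> t\<^sub>1 \<Longrightarrow> \<not> discharged (k t) (fst (s t)) g"
  obtains a b t\<^sub>2 where "g = Avoid a b" "\<And>t. t \<ge> t\<^sub>2 \<Longrightarrow> b \<notin> fst (s t)"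
proof -
  have st: "step (k t) (s t) (s (Suc t))" for t using run by (simp add: run_def)
  obtain t\<^sub>2 zs where t2: "t\<^sub>2 \<ge> t\<^sub>1" and pre: "\<And>t. t \<ge> t\<^sub>2 \<Longrightarrow> \<exists>ys. snd (s t) = zs @ g # ys"
    and undone_zs: "\<And>t x. t \<ge> t\<^sub>2 \<Longrightarrow> x \<in> set zs \<Longrightarrow> \<not> discharged (k t) (fst (s t)) x"
    using prefix_eventually_constant[of "\<lambda>t. snd (s t)" "\<lambda>t. discharged (k t) (fst (s t))" g t\<^sub>1]
      st undone g run by (auto simp: step_def run_def state_def)
  define xs where "xs = zs @ [g]"
  have nth: "m < length (snd (s t)) \<and> snd (s t) ! m = xs ! m"
    if "t \<ge> t\<^sub>2" "m < length xs" for t m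
    using pre[OF that(1)] that(2) by (auto simp: xs_def nth_append)
  have xs: "xs ! m \<in> I \<and> \<not> discharged (k t) (fst (s t)) (xs ! m)" if "t \<ge> t\<^sub>2" "m < length xs" for t m
  proof -
    have "xs ! m \<in> set xs" using that by simp
    then have "xs ! m \<in> set zs \<or> xs ! m = g" by (auto simp: xs_def)
    moreover have "set zs \<subseteq> I"
      using pre[of t\<^sub>2] run_state[OF run, of t\<^sub>2] by (auto simp: state_def)
    ultimately show ?thesis using undone_zs undone g that t2 by auto
  qed
  have "\<exists>v. serves (k t) (fst (s t)) (snd (s t)) v \<and> settlement (snd (s (Suc t))) v (fst (s (Suc t)))" for t
    using st[of t] unfolding step_def by blast
  then obtain v where v: "\<And>t. serves (k t) (fst (s t)) (snd (s t)) (v t)"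
    "\<And>t. settlement (snd (s (Suc t))) (v t) (fst (s (Suc t)))" by metis
  have main: "\<exists>t\<^sub>3\<ge>t\<^sub>2. \<forall>t\<ge>t\<^sub>3. settled j (xs ! j) (v t) \<and>
      (\<exists>a b. xs ! j = Avoid a b \<and> b \<notin> fst (s (Suc t)))" if "j < length xs" for j
    using that
  proof (induction j rule: less_induct)
    case (less j)
    have "\<exists>t\<^sub>3. \<forall>m<j. \<forall>t\<ge>t\<^sub>3. settled m (xs ! m) (v t)"
    proof -
      have "\<forall>m. \<exists>t\<^sub>3. m < j \<longrightarrow> (\<forall>t\<ge>t\<^sub>3. settled m (xs ! m) (v t))"
        using less by (meson less_trans)
      then obtain T where T: "\<And>m t. m < j \<Longrightarrow> t \<ge> T m \<Longrightarrow> settled m (xs ! m) (v t)" by metis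
      have "T m \<le> Max (T ` {..<j})" if "m < j" for m using that by simp
      then show ?thesis using T by (meson order_trans)
    qed
    then obtain t\<^sub>3 where t3: "\<And>m t. m < j \<Longrightarrow> t \<ge> t\<^sub>3 \<Longrightarrow> settled m (xs ! m) (v t)" by blast
    define t\<^sub>4 where "t\<^sub>4 = max t\<^sub>2 t\<^sub>3"
    have rank: "rk j (xs ! j) (fst (s (Suc t))) \<le> rk j (xs ! j) (fst (s t))"
      "rk j (xs ! j) (fst (s (Suc t))) = rk j (xs ! j) (fst (s t)) \<Longrightarrow>
        settled j (xs ! j) (v t) \<and> (\<exists>a b. xs ! j = Avoid a b \<and> b \<notin> fst (s (Suc t)))"
      if t: "t \<ge> t\<^sub>4" for t
    proof -
      have t': "t \<ge> t\<^sub>2" "Suc t \<ge> t\<^sub>2" "t \<ge> t\<^sub>3" using t by (auto simp: t\<^sub>4_def)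
      have pos: "snd (s (Suc t)) ! m = snd (s t) ! m" if "m \<le> j" for m
        using nth t' that less.prems by simp
      have prev: "settled m (snd (s t) ! m) (v t)" if "m < j" for m
        using nth t' that less.prems t3 by simp
      have 1: "j < length (snd (s t))" "snd (s t) ! j = xs ! j" "xs ! j \<in> I" "j < length (snd (s (Suc t)))"
        "\<not> discharged (k t) (fst (s t)) (xs ! j)"
        using nth xs t' less.prems by auto
      show "rk j (xs ! j) (fst (s (Suc t))) \<le> rk j (xs ! j) (fst (s t))"
        by (rule step_rank(1)[OF st 1 pos v(2) v(1) prev])
      show "settled j (xs ! j) (v t) \<and> (\<exists>a b. xs ! j = Avoid a b \<and> b \<notin> fst (s (Suc t)))"
        if "rk j (xs ! j) (fst (s (Suc t))) = rk j (xs ! j) (fst (s t))"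
        by (rule step_rank(2)[OF st 1 pos v(2) v(1) prev that])
    qed
    obtain t\<^sub>5 where "t\<^sub>5 \<ge> t\<^sub>4" "\<And>t. t \<ge> t\<^sub>5 \<Longrightarrow> rk j (xs ! j) (fst (s (Suc t))) = rk j (xs ! j) (fst (s t))"
      using decreasing_nat_eventually_constant[of t\<^sub>4 "\<lambda>t. rk j (xs ! j) (fst (s t))"] rank(1) by blast
    then show ?case using rank(2) by (intro exI[of _ t\<^sub>5]) (auto simp: t\<^sub>4_def)
  qed
  obtain t\<^sub>3 where t3: "\<And>t. t \<ge> t\<^sub>3 \<Longrightarrow> \<exists>a b. g = Avoid a b \<and> b \<notin> fst (s (Suc t))"
    using main[of "length zs"] by (auto simp: xs_def)
  then obtain a b where g': "g = Avoid a b" by blast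
  have "b \<notin> fst (s t)" if "t \<ge> Suc t\<^sub>3" for t
    using t3[of "t - 1"] that g' by (cases t) auto
  then show thesis using that g' by blast
qed

text \<open>A run serving only \<open>Reach a b\<close> until \<open>a\<close> holds would otherwise never discharge this
  task.\<close>

lemma run_Reach:
  assumes run: "run s k" and g: "Reach a b \<in> I" and k: "\<And>t. t \<ge> t\<^sub>0 \<Longrightarrow> a \<notin> fst (s t) \<Longrightarrow> k t = Reach a b"
    and start: "eu a b \<in> fst (s t\<^sub>0)"
  shows "\<exists>t\<ge>t\<^sub>0. a \<in> fst (s t) \<and> (\<forall>m. t\<^sub>0 \<le> m \<longrightarrow> m < t \<longrightarrow> b \<in> fst (s m))"
proof -
  have keep: "eu a b \<in> fst (s t)" if "t \<ge> t\<^sub>0" "\<And>m. t\<^sub>0 \<le> m \<Longrightarrow> m < t \<Longrightarrow> a \<notin> fst (s m)" for t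
    using that
  proof (induction t rule: dec_induct)
    case (step t)
    have "k t = Reach a b" using k[of t] step by simp
    moreover have "step (k t) (s t) (s (Suc t))" using run by (simp add: run_def)
    ultimately have "step (Reach a b) (s t) (s (Suc t))" by simp
    moreover have "eu a b \<in> fst (s t)" "a \<notin> fst (s t)" using step by auto
    ultimately show ?case using g step_Reach by blast
  qed (rule start)
  have "\<exists>t. t \<ge> t\<^sub>0 \<and> a \<in> fst (s t)"
  proof (rule ccontr)
    assume "\<not> ?thesis"
    then have "\<not> discharged (k t) (fst (s t)) (Reach a b)" if "t \<ge> t\<^sub>0" for t
      using keep[of t] k[of t] that by simp
    then show False using run_undischarged[OF run g] by blast
  qed
  then obtain t where t: "t \<ge> t\<^sub>0" "a \<in> fst (s t)" "\<And>m. m < t \<Longrightarrow> \<not> (m \<ge> t\<^sub>0 \<and> a \<in> fst (s m))"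
    using exists_least_iff[of "\<lambda>t. t \<ge> t\<^sub>0 \<and> a \<in> fst (s t)"] by blast
  have "b \<in> fst (s m)" if "t\<^sub>0 \<le> m" "m < t" for m
  proof -
    have "eu a b \<in> fst (s m)" "a \<notin> fst (s m)" using keep[of m] t(3) that by auto
    moreover have "ultrafilter (fst (s m))" using run_state[OF run] by (simp add: state_def)
    ultimately show ?thesis using eu_unfold_in[of "fst (s m)" a b] by blast
  qed
  then show ?thesis using t by blast
qed

lemma run_Avoid:
  assumes run: "run s k" and g: "Avoid a b \<in> I" and a: "\<And>t. a \<in> fst (s t)"
    and inf: "infinite {t. b \<in> fst (s t)}"
  shows "eg a b \<in> fst (s 0)"
proof (rule ccontr)
  assume no: "eg a b \<notin> fst (s 0)"
  have "eg a b \<notin> fst (s t)" for t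
  proof (induction t)
    case (Suc t)
    have "step (k t) (s t) (s (Suc t))" using run by (simp add: run_def)
    then show ?case using step_eg g a Suc by blast
  qed (rule no)
  then have "\<not> discharged (k t) (fst (s t)) (Avoid a b)" for t using a by simp
  then obtain t\<^sub>2 where "\<And>t. t \<ge> t\<^sub>2 \<Longrightarrow> b \<notin> fst (s t)" using run_undischarged[OF run g] by blast
  then have "{t. b \<in> fst (s t)} \<subseteq> {..<t\<^sub>2}" by (auto simp: not_le[symmetric])
  then show False using inf finite_subset by blast
qed

end

section \<open>The tree of finite sequences\<close>

text \<open>The tree of all finite sequences of natural numbers, coded by natural numbers; its root is the
  code of the empty sequence.\<close>

definition tree_edges :: "nat rel" where
  "tree_edges = {(list_encode xs, list_encode (xs @ [k])) | xs k. True}"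

lemma tree_edges_iff:
  "(m, n) \<in> tree_edges \<longleftrightarrow> (\<exists>k. list_decode n = list_decode m @ [k])"
proof
  show "(m, n) \<in> tree_edges" if "\<exists>k. list_decode n = list_decode m @ [k]"
    using that unfolding tree_edges_def by (metis (mono_tags, lifting) list_decode_inverse mem_Collect_eq)
qed (auto simp: tree_edges_def)

lemma fin_path_snoc:
  assumes "p \<noteq> []"
  shows "fin_path S R (p @ [n]) \<longleftrightarrow> fin_path S R p \<and> n \<in> S \<and> (last p, n) \<in> R"
proof -
  have "(\<forall>i. Suc i < length (p @ [n]) \<longrightarrow> ((p @ [n]) ! i, (p @ [n]) ! Suc i) \<in> R) \<longleftrightarrow>
    (\<forall>i. Suc i < length p \<longrightarrow> (p ! i, p ! Suc i) \<in> R) \<and> (last p, n) \<in> R" (is "?l \<longleftrightarrow> ?r")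
  proof
    assume l: ?l
    have "(p ! i, p ! Suc i) \<in> R" if "Suc i < length p" for i
      using l[rule_format, of i] that by (simp add: nth_append)
    moreover have "(last p, n) \<in> R"
      using l[rule_format, of "length p - 1"] assms by (simp add: nth_append last_conv_nth)
    ultimately show ?r by blast
  next
    assume r: ?r
    show ?l
    proof (intro allI impI)
      fix i assume "Suc i < length (p @ [n])"
      then consider "Suc i < length p" | "i = length p - 1" using assms by fastforce
      then show "((p @ [n]) ! i, (p @ [n]) ! Suc i) \<in> R"
        by cases (use r assms in \<open>auto simp: nth_append last_conv_nth\<close>)
    qed
  qed
  then show ?thesis using assms by (auto simp: fin_path_def)
qed

text \<open>The path from the root to \<open>n\<close>, consisting of the codes of the initial segments.\<close>

definition root_path :: "nat \<Rightarrow> nat list" where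
  "root_path n =
     map (\<lambda>i. list_encode (take i (list_decode n))) [0..<Suc (length (list_decode n))]"

lemma hd_root_path: "hd (root_path n) = list_encode []"
  by (simp add: root_path_def hd_map del: upt_Suc)

lemma last_root_path: "last (root_path n) = n"
  by (simp add: root_path_def)

lemma root_path_snoc:
  assumes "list_decode n = list_decode m @ [k]"
  shows "root_path n = root_path m @ [n]"
proof -
  have "list_encode (list_decode m @ [k]) = n" by (simp flip: assms)
  then show ?thesis by (simp add: root_path_def assms)
qed

lemma root_path_root: "root_path (list_encode []) = [list_encode []]"
  by (simp add: root_path_def)

lemma fin_path_root_path: "fin_path UNIV tree_edges (root_path n)"
proof -
  have "fin_path UNIV tree_edges (root_path (list_encode xs))" for xs
  proof (induction xs rule: rev_induct)
    case Nil
    show ?case unfolding root_path_root by (simp add: fin_path_def)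
  next
    case (snoc k xs)
    let ?n = "list_encode (xs @ [k])"
    have "root_path ?n = root_path (list_encode xs) @ [?n]"
      by (rule root_path_snoc[of _ _ k]) simp
    moreover have "root_path (list_encode xs) \<noteq> []" by (simp add: root_path_def)
    moreover have "(list_encode xs, ?n) \<in> tree_edges" by (simp add: tree_edges_iff)
    ultimately show ?case using snoc by (simp add: fin_path_snoc last_root_path)
  qed
  from this[of "list_decode n"] show ?thesis by simp
qed

lemma fin_path_from_root:
  assumes "fin_path UNIV tree_edges p" "hd p = list_encode []"
  shows "p = root_path (last p)"
  using assms
proof (induction p rule: rev_induct)
  case Nil
  then show ?case by (simp add: fin_path_def)
next
  case (snoc n p)
  show ?case
  proof (cases "p = []")
    case True
    then show ?thesis using snoc.prems(2) root_path_root by simp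
  next
    case False
    then have p: "fin_path UNIV tree_edges p" "(last p, n) \<in> tree_edges"
      using snoc.prems(1) by (auto simp: fin_path_snoc)
    have "p = root_path (last p)" using snoc.IH[OF p(1)] snoc.prems(2) False by simp
    moreover obtain k where "list_decode n = list_decode (last p) @ [k]"
      using p(2) by (auto simp: tree_edges_iff)
    ultimately show ?thesis using root_path_snoc[of n "last p" k] by simp
  qed
qed

lemma rooted_tree_tree_edges: "rooted_tree UNIV tree_edges (list_encode [])"
proof
  fix s :: nat
  show "\<exists>s'. (s, s') \<in> tree_edges"
    by (rule exI[of _ "list_encode (list_decode s @ [0])"]) (simp add: tree_edges_iff)
  show "\<exists>!xs. fin_path UNIV tree_edges xs \<and> hd xs = list_encode [] \<and> last xs = s"
    using fin_path_from_root
    by (intro ex1I[of _ "root_path s"])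
      (auto simp: fin_path_root_path hd_root_path last_root_path simp del: list_encode.simps)
next
  have "p = [list_encode []]" if p: "fin_path UNIV tree_edges p" "last p = list_encode []" for p
  proof (cases p rule: rev_cases)
    case Nil
    then show ?thesis using p by (simp add: fin_path_def)
  next
    case (snoc q n)
    have "q = []"
    proof (rule ccontr)
      assume "q \<noteq> []"
      then have "(last q, list_encode []) \<in> tree_edges" using p snoc by (simp add: fin_path_snoc)
      then show False by (simp add: tree_edges_iff)
    qed
    then show ?thesis using p snoc by simp
  qed
  moreover have "\<exists>p. fin_path UNIV tree_edges p \<and> hd p = list_encode [] \<and> last p = s" for s
    using fin_path_root_path hd_root_path last_root_path by blast
  ultimately show "is_root UNIV tree_edges (list_encode [])"
    unfolding is_root_def by blast
qed simp

section \<open>Truth in the tree\<close>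

context ctlf_algebra
begin

text \<open>The tasks arising from the subformulas of a formula. For \<open>EG\<close> the \<open>Reach\<close> and
  \<open>Next\<close> tasks serve to find a witnessing path.\<close>

primrec tasks :: "('p \<Rightarrow> 'a) \<Rightarrow> 'p ctlf \<Rightarrow> 'a task set" where
  "tasks V (Var p) = {}"
| "tasks V Bot = {}"
| "tasks V (Neg \<phi>) = tasks V \<phi>"
| "tasks V (Dia \<phi>) = insert (Next (interp dia eu eg V \<phi>)) (tasks V \<phi>)"
| "tasks V (Or \<phi> \<psi>) = tasks V \<phi> \<union> tasks V \<psi>"
| "tasks V (EU \<phi> \<psi>) =
     insert (Reach (interp dia eu eg V \<phi>) (interp dia eu eg V \<psi>)) (tasks V \<phi> \<union> tasks V \<psi>)"
| "tasks V (EG \<phi> \<psi>) =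
     (let a = interp dia eu eg V \<phi>; b = interp dia eu eg V \<psi>; c = inf b (eg a b)
      in {Avoid a b, Reach c a, Next (eu c a)} \<union> (tasks V \<phi> \<union> tasks V \<psi>))"

lemma finite_tasks_formula: "finite (tasks V \<phi>)"
  by (induction \<phi>) (auto simp: Let_def)

end

text \<open>The \<open>k\<close>-th child of every node serves the task \<open>lab k\<close>; every task in
  \<open>I\<close> occurs as a label, and children whose label is not in \<open>I\<close> do no harm.\<close>

locale strategy_tree = strategy dia eu eg I
  for dia :: "'a::boolean_algebra \<Rightarrow> 'a" and eu eg and I :: "'a task set" +
  fixes lab :: "nat \<Rightarrow> 'a task" and s\<^sub>0 :: "'a set \<times> 'a task list"
  assumes lab: "I \<subseteq> range lab" and init: "state s\<^sub>0"
begin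

text \<open>The state reached from \<open>s\<^sub>0\<close> along the path to \<open>n\<close>, and its ultrafilter.\<close>

definition state_at :: "nat \<Rightarrow> 'a set \<times> 'a task list" where
  "state_at n = foldl (\<lambda>s k. SOME s'. step (lab k) s s') s\<^sub>0 (list_decode n)"

definition world :: "nat \<Rightarrow> 'a set" where
  "world n = fst (state_at n)"

lemma state_state_at: "state (state_at n)"
proof -
  have "state (foldl (\<lambda>s k. SOME s'. step (lab k) s s') s\<^sub>0 xs)" for xs
    by (induction xs rule: rev_induct) (auto simp: init intro: step_state someI_ex[OF step_exists])
  then show ?thesis by (simp add: state_at_def)
qed

lemma ultrafilter_world: "ultrafilter (world n)"
  using state_state_at by (simp add: world_def state_def)

lemma step_state_at:
  assumes "list_decode n = list_decode m @ [k]"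
  shows "step (lab k) (state_at m) (state_at n)"
proof -
  have "state_at n = (SOME s'. step (lab k) (state_at m) s')"
    by (simp add: state_at_def assms)
  then show ?thesis using someI_ex[OF step_exists[OF state_state_at]] by simp
qed

lemma edge_step:
  assumes "(m, n) \<in> tree_edges"
  obtains k where "step k (state_at m) (state_at n)"
  using assms step_state_at by (auto simp: tree_edges_iff)

lemma inf_path_run:
  assumes "inf_path UNIV tree_edges \<pi>"
  obtains k where "run (\<lambda>t. state_at (\<pi> t)) k"
proof -
  have "\<exists>k. step k (state_at (\<pi> t)) (state_at (\<pi> (Suc t)))" for t
    using assms edge_step unfolding inf_path_def by metis
  then show thesis using that state_state_at unfolding run_def by metis
qed

text \<open>From every node, some branch always moves to the child serving the task that \<open>\<kappa>\<close> selects
  for the current ultrafilter.\<close>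

lemma run_following:
  assumes \<kappa>: "\<And>u. \<kappa> u \<in> I"
  obtains \<pi> where "inf_path UNIV tree_edges \<pi>" "\<pi> 0 = n"
    "run (\<lambda>t. state_at (\<pi> t)) (\<lambda>t. \<kappa> (world (\<pi> t)))"
proof -
  have "\<exists>m. (n, m) \<in> tree_edges \<and> step (\<kappa> (world n)) (state_at n) (state_at m)" for n
  proof -
    obtain k where k: "lab k = \<kappa> (world n)" using \<kappa> lab by (metis imageE subsetD)
    let ?m = "list_encode (list_decode n @ [k])"
    have "step (\<kappa> (world n)) (state_at n) (state_at ?m)"
      using step_state_at[of ?m n k] k by simp
    then show ?thesis by (intro exI[of _ ?m]) (simp add: tree_edges_iff)
  qed
  then obtain nxt where nxt: "\<And>n. (n, nxt n) \<in> tree_edges"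
    "\<And>n. step (\<kappa> (world n)) (state_at n) (state_at (nxt n))" by metis
  show thesis
    by (rule that[of "\<lambda>t. (nxt ^^ t) n"]) (simp_all add: inf_path_def run_def nxt state_state_at)
qed

lemma world_EU:
  assumes "Reach a b \<in> I"
  shows "eu a b \<in> world n \<longleftrightarrow>
    (\<exists>m xs. fin_path UNIV tree_edges xs \<and> length xs = Suc m \<and> xs ! 0 = n \<and>
        (\<forall>t<m. b \<in> world (xs ! t)) \<and> a \<in> world (xs ! m))" (is "_ \<longleftrightarrow> ?path")
proof
  assume eu: "eu a b \<in> world n"
  obtain \<pi> where \<pi>: "inf_path UNIV tree_edges \<pi>" "\<pi> 0 = n"
    "run (\<lambda>t. state_at (\<pi> t)) (\<lambda>t. Reach a b)"
    using run_following[of "\<lambda>_. Reach a b"] assms by metis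
  then obtain m where m: "a \<in> world (\<pi> m)" "\<forall>t<m. b \<in> world (\<pi> t)"
    using run_Reach[OF \<pi>(3) assms, of 0] eu by (auto simp: world_def)
  show ?path
    using \<pi> m by (intro exI[of _ m] exI[of _ "map \<pi> [0..<Suc m]"])
      (auto simp: fin_path_def inf_path_def simp del: upt_Suc)
next
  assume ?path
  then obtain m xs where xs: "fin_path UNIV tree_edges xs" "length xs = Suc m" "xs ! 0 = n"
    "\<And>t. t < m \<Longrightarrow> b \<in> world (xs ! t)" "a \<in> world (xs ! m)" by auto
  have "eu a b \<in> world (xs ! t)" if "t \<le> m" for t
    using that
  proof (induction t rule: inc_induct)
    case base
    then show ?case using xs(5) eu_unfold_in[OF ultrafilter_world] by blast
  next
    case (step t)
    then have "(xs ! t, xs ! Suc t) \<in> tree_edges" using xs by (auto simp: fin_path_def)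
    then obtain k where "step k (state_at (xs ! t)) (state_at (xs ! Suc t))" by (rule edge_step)
    then show ?case using step_eu[OF _ assms] step.IH xs(4) step.hyps unfolding world_def by blast
  qed
  from this[of 0] show "eu a b \<in> world n" using xs by simp
qed

text \<open>If \<open>eg a b\<close> holds, let \<open>c = inf b (eg a b)\<close>. The witnessing path keeps
  \<open>eu c a\<close> true throughout: it heads for \<open>c\<close> by serving \<open>Reach c a\<close>, and where
  \<open>c\<close> holds, it serves \<open>Next (eu c a)\<close>.\<close>

lemma world_EG:
  assumes I: "Avoid a b \<in> I" "Reach (inf b (eg a b)) a \<in> I" "Next (eu (inf b (eg a b)) a) \<in> I"
  shows "eg a b \<in> world n \<longleftrightarrow>
    (\<exists>\<pi>. inf_path UNIV tree_edges \<pi> \<and> \<pi> 0 = n \<and> (\<forall>t. a \<in> world (\<pi> t)) \<and>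
       infinite {t. b \<in> world (\<pi> t)})" (is "_ \<longleftrightarrow> ?path")
proof
  let ?c = "inf b (eg a b)"
  let ?f = "eu ?c a"
  assume eg: "eg a b \<in> world n"
  define \<kappa> where "\<kappa> u = (if ?c \<in> u then Next ?f else Reach ?c a)" for u
  have "\<kappa> u \<in> I" for u using I by (simp add: \<kappa>_def)
  then obtain \<pi> where \<pi>: "inf_path UNIV tree_edges \<pi>" "\<pi> 0 = n"
    "run (\<lambda>t. state_at (\<pi> t)) (\<lambda>t. \<kappa> (world (\<pi> t)))"
    by (rule run_following)
  have c: "a \<in> world m \<and> dia ?f \<in> world m" if "?c \<in> world m" for m
    using that eg_unfold_in[OF ultrafilter_world, of a b m]
    by (simp add: ultrafilter_inf[OF ultrafilter_world])
  have f: "?f \<in> world (\<pi> t)" for t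
  proof (induction t)
    case 0
    then show ?case
      using eg eg_unfold_in[OF ultrafilter_world, of a b n]
        eu_unfold_in[OF ultrafilter_world, of ?c a n] \<pi>(2) by simp
  next
    case (Suc t)
    have "step (\<kappa> (world (\<pi> t))) (state_at (\<pi> t)) (state_at (\<pi> (Suc t)))"
      using \<pi>(3) by (simp add: run_def)
    then show ?case
      using Suc c[of "\<pi> t"] step_Next[OF _ I(3)] step_Reach[OF _ I(2)]
      by (cases "?c \<in> world (\<pi> t)") (auto simp: \<kappa>_def world_def)
  qed
  have "a \<in> world (\<pi> t)" for t
    using f[of t] c[of "\<pi> t"] eu_unfold_in[OF ultrafilter_world, of ?c a "\<pi> t"] by blast
  moreover have "infinite {t. b \<in> world (\<pi> t)}"
  proof
    assume "finite {t. b \<in> world (\<pi> t)}"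
    then obtain t\<^sub>0 where t0: "\<And>t. b \<in> world (\<pi> t) \<Longrightarrow> t < t\<^sub>0"
      by (auto simp: finite_nat_set_iff_bounded)
    obtain t where "t \<ge> t\<^sub>0" "?c \<in> world (\<pi> t)"
      using run_Reach[OF \<pi>(3) I(2), of t\<^sub>0] f[of t\<^sub>0] by (auto simp: \<kappa>_def world_def)
    then show False using t0[of t] by (simp add: ultrafilter_inf[OF ultrafilter_world])
  qed
  ultimately show ?path using \<pi> by blast
next
  assume ?path
  then obtain \<pi> where \<pi>: "inf_path UNIV tree_edges \<pi>" "\<pi> 0 = n" "\<And>t. a \<in> world (\<pi> t)"
    "infinite {t. b \<in> world (\<pi> t)}" by auto
  obtain k where "run (\<lambda>t. state_at (\<pi> t)) k" using inf_path_run[OF \<pi>(1)] .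
  then show "eg a b \<in> world n" using run_Avoid[OF _ I(1)] \<pi>(2-4) unfolding world_def by metis
qed

lemma world_Dia:
  assumes "Next c \<in> I"
  shows "dia c \<in> world n \<longleftrightarrow> (\<exists>m. (n, m) \<in> tree_edges \<and> c \<in> world m)"
proof
  assume dia: "dia c \<in> world n"
  obtain \<pi> where \<pi>: "inf_path UNIV tree_edges \<pi>" "\<pi> 0 = n"
    "run (\<lambda>t. state_at (\<pi> t)) (\<lambda>t. Next c)"
    using run_following[of "\<lambda>_. Next c"] assms by metis
  have "step (Next c) (state_at n) (state_at (\<pi> 1))" "(n, \<pi> 1) \<in> tree_edges"
    using \<pi> unfolding run_def inf_path_def by (metis One_nat_def)+
  then show "\<exists>m. (n, m) \<in> tree_edges \<and> c \<in> world m"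
    using step_Next assms dia unfolding world_def by blast
next
  show "dia c \<in> world n" if "\<exists>m. (n, m) \<in> tree_edges \<and> c \<in> world m"
    using that edge_step step_dia[OF _ assms] unfolding world_def by metis
qed

lemma truth:
  assumes \<sigma>: "\<And>n p. p \<in> vars \<phi> \<Longrightarrow> p \<in> \<sigma> n \<longleftrightarrow> V p \<in> world n" and "tasks V \<phi> \<subseteq> I"
  shows "forces UNIV tree_edges \<sigma> n \<phi> \<longleftrightarrow> interp dia eu eg V \<phi> \<in> world n"
  using assms
proof (induction \<phi> arbitrary: n)
  case (EU \<phi> \<psi>)
  then show ?case using world_EU by simp
next
  case (EG \<phi> \<psi>)
  then show ?case using world_EG by (simp add: Let_def)
qed (auto simp: world_Dia ultrafilter_simps[OF ultrafilter_world])

end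

section \<open>Completeness\<close>

theorem theorem3p2:
  fixes P :: "'p set" and \<phi>\<^sub>0 :: "'p ctlf"
  assumes "finite P"
    and "vars \<phi>\<^sub>0 \<subseteq> P"
    and "consistent TYPE('a::boolean_algebra) \<phi>\<^sub>0"
  shows "\<exists>(S :: nat set) R \<sigma> s\<^sub>0.
    rooted_tree S R s\<^sub>0 \<and> colouring P S \<sigma> \<and> forces S R \<sigma> s\<^sub>0 \<phi>\<^sub>0"
proof -
  obtain dia :: "'a \<Rightarrow> 'a" and eu eg and V :: "'p \<Rightarrow> 'a"
    where alg: "ctlf_algebra dia eu eg" and ne: "interp dia eu eg V \<phi>\<^sub>0 \<noteq> bot"
    using assms(3) unfolding consistent_def by blast
  interpret ctlf_algebra dia eu eg by (rule alg)
  define I where "I = tasks V \<phi>\<^sub>0"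
  have "finite I" by (simp add: I_def finite_tasks_formula)
  then obtain ts where ts: "set ts = I" "distinct ts" using finite_distinct_list by blast
  interpret strategy dia eu eg I by unfold_locales (rule \<open>finite I\<close>)
  obtain u where u: "ultrafilter u" "interp dia eu eg V \<phi>\<^sub>0 \<in> u"
    using ultrafilter_exists[OF ne] by blast
  \<comment> \<open>The list of all tasks serves both as the labelling of the children and as the initial priority list.\<close>
  have "I \<subseteq> range (nth ts)" using ts by (auto simp: in_set_conv_nth)
  then interpret strategy_tree dia eu eg I "nth ts" "(u, ts)"
    using u ts by unfold_locales (auto simp: state_def)
  define \<sigma> where "\<sigma> n = {p \<in> P. V p \<in> world n}" for n
  have "world (list_encode []) = u" by (simp add: world_def state_at_def)
  then have "forces UNIV tree_edges \<sigma> (list_encode []) \<phi>\<^sub>0"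
    using truth[of \<phi>\<^sub>0 \<sigma> V] assms(2) u(2) by (auto simp: \<sigma>_def I_def)
  moreover have "colouring P UNIV \<sigma>" by (auto simp: colouring_def \<sigma>_def)
  ultimately show ?thesis using rooted_tree_tree_edges by blast
qed

end
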